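(* For any positive integers $r$ and $t$ with $r\not\equiv0\pmod3$, the lens spaces $L(r^2t;\,1,\,1+rt,\,1+3rt)$ and $L(r^2t;\,1,\,1-rt,\,1-3rt)$ are homotopically equivalent to each other.
   Context: For $q\in\mathbb N$ and $s_1,s_2,s_3\in\mathbb Z$ coprime to $q$, the lens space $L(q;s_1,s_2,s_3)$ is $\langle\gamma\rangle\backslash S^5$, where $\gamma\in\mathrm{SO}(6)$ is block diagonal with $j$-th $2\times2$ block the rotation $\begin{pmatrix}\cos(2\pi s_j/q)&-\sin(2\pi s_j/q)\\ \sin(2\pi s_j/q)&\cos(2\pi s_j/q)\end{pmatrix}$. *)

theory Defs
  imports
    "HOL-Analysis.Analysis"
    "HOL-Algebra.Generated_Groups"
    "HOL-Algebra.Group_Action"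
    "HOL-Number_Theory.Cong"
begin

section \<open>The special orthogonal group\<close>

definition special_orthogonal_group :: "(real^'n^'n) monoid" where
  "special_orthogonal_group =
     \<lparr>carrier = {A. orthogonal_matrix A \<and> det A = 1}, mult = (**), one = mat 1\<rparr>"

lemma group_special_orthogonal_group:
  "group (special_orthogonal_group :: (real^'n^'n) monoid)"
proof (rule groupI)
  fix A :: "real^'n^'n"
  assume "A \<in> carrier special_orthogonal_group"
  then have A: "orthogonal_matrix A" "det A = 1"
    by (auto simp: special_orthogonal_group_def)
  then have "transpose A \<in> carrier special_orthogonal_group"
    by (simp add: special_orthogonal_group_def det_transpose)
  moreover have "transpose A \<otimes>\<^bsub>special_orthogonal_group\<^esub> A = \<one>\<^bsub>special_orthogonal_group\<^esub>"
    using A by (simp add: special_orthogonal_group_def orthogonal_matrix)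
  ultimately show "\<exists>B\<in>carrier special_orthogonal_group.
      B \<otimes>\<^bsub>special_orthogonal_group\<^esub> A = \<one>\<^bsub>special_orthogonal_group\<^esub>"
    by blast
qed (auto simp: special_orthogonal_group_def orthogonal_matrix_mul det_mul
       orthogonal_matrix_id matrix_mul_assoc)

section \<open>Quotient topology\<close>

definition quotient_topology :: "'a topology \<Rightarrow> ('a \<Rightarrow> 'b) \<Rightarrow> 'b topology" where
  "quotient_topology X p =
     topology (\<lambda>U. U \<subseteq> p ` topspace X \<and> openin X {x \<in> topspace X. p x \<in> U})"

lemma openin_quotient_topology:
  "openin (quotient_topology X p) U \<longleftrightarrow>
     U \<subseteq> p ` topspace X \<and> openin X {x \<in> topspace X. p x \<in> U}"
proof -
  have "istopology (\<lambda>U. U \<subseteq> p ` topspace X \<and> openin X {x \<in> topspace X. p x \<in> U})"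
    unfolding istopology_def
  proof (intro conjI allI impI)
    fix S T
    assume S: "S \<subseteq> p ` topspace X \<and> openin X {x \<in> topspace X. p x \<in> S}"
      and T: "T \<subseteq> p ` topspace X \<and> openin X {x \<in> topspace X. p x \<in> T}"
    show "S \<inter> T \<subseteq> p ` topspace X" using S by blast
    have "{x \<in> topspace X. p x \<in> S \<inter> T} =
        {x \<in> topspace X. p x \<in> S} \<inter> {x \<in> topspace X. p x \<in> T}" by blast
    then show "openin X {x \<in> topspace X. p x \<in> S \<inter> T}" using S T by auto
  next
    fix K
    assume K: "\<forall>U\<in>K. U \<subseteq> p ` topspace X \<and> openin X {x \<in> topspace X. p x \<in> U}"
    show "\<Union>K \<subseteq> p ` topspace X" using K by blast
    have "{x \<in> topspace X. p x \<in> \<Union>K} = (\<Union>U\<in>K. {x \<in> topspace X. p x \<in> U})" by blast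
    then show "openin X {x \<in> topspace X. p x \<in> \<Union>K}" using K by auto
  qed
  then show ?thesis
    by (simp add: quotient_topology_def topology_inverse')
qed

lemma topspace_quotient_topology [simp]:
  "topspace (quotient_topology X p) = p ` topspace X"
proof
  show "topspace (quotient_topology X p) \<subseteq> p ` topspace X"
    using openin_quotient_topology[of X p] openin_topspace by blast
  have "{x \<in> topspace X. p x \<in> p ` topspace X} = topspace X" by blast
  then have "openin (quotient_topology X p) (p ` topspace X)"
    by (simp add: openin_quotient_topology)
  then show "p ` topspace X \<subseteq> topspace (quotient_topology X p)"
    by (rule openin_subset)
qed

lemma quotient_map_quotient_topology:
  "quotient_map X (quotient_topology X p) p"
  by (auto simp: quotient_map_def openin_quotient_topology)

section \<open>Lens spaces\<close>

definition block_rotation :: "real \<Rightarrow> real \<Rightarrow> real \<Rightarrow> real^6^6" where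
  "block_rotation a b c = vector
     [vector [cos a, - sin a, 0, 0, 0, 0],
      vector [sin a,   cos a, 0, 0, 0, 0],
      vector [0, 0, cos b, - sin b, 0, 0],
      vector [0, 0, sin b,   cos b, 0, 0],
      vector [0, 0, 0, 0, cos c, - sin c],
      vector [0, 0, 0, 0, sin c,   cos c]]"

definition lens_generator :: "nat \<Rightarrow> int \<Rightarrow> int \<Rightarrow> int \<Rightarrow> real^6^6" where
  "lens_generator q s\<^sub>1 s\<^sub>2 s\<^sub>3 =
     block_rotation (2 * pi * s\<^sub>1 / q) (2 * pi * s\<^sub>2 / q) (2 * pi * s\<^sub>3 / q)"

definition lens_group :: "nat \<Rightarrow> int \<Rightarrow> int \<Rightarrow> int \<Rightarrow> (real^6^6) monoid" where
  "lens_group q s\<^sub>1 s\<^sub>2 s\<^sub>3 =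
     special_orthogonal_group
       \<lparr>carrier := generate special_orthogonal_group {lens_generator q s\<^sub>1 s\<^sub>2 s\<^sub>3}\<rparr>"

text \<open>The points of the lens space are the orbits in the unit sphere of \<open>\<real>\<^sup>6\<close>. The definition is
  meant for \<open>q > 0\<close> and \<open>s\<^sub>1, s\<^sub>2, s\<^sub>3\<close> coprime to \<open>q\<close>, i.e. for a free action.\<close>

definition lens_space :: "nat \<Rightarrow> int \<Rightarrow> int \<Rightarrow> int \<Rightarrow> (real^6) set topology" where
  "lens_space q s\<^sub>1 s\<^sub>2 s\<^sub>3 =
     quotient_topology (top_of_set (sphere 0 1)) (orbit (lens_group q s\<^sub>1 s\<^sub>2 s\<^sub>3) (*v))"

lemma exhaust_6:
  fixes x :: 6
  shows "x = 1 \<or> x = 2 \<or> x = 3 \<or> x = 4 \<or> x = 5 \<or> x = 6"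
proof (induct x)
  case (of_int z)
  then have "z = 0 \<or> z = 1 \<or> z = 2 \<or> z = 3 \<or> z = 4 \<or> z = 5" by fastforce
  then show ?case by auto
qed

lemma UNIV_6: "UNIV = {1, 2, 3, 4, 5, 6::6}"
  using exhaust_6 by blast

lemma forall_6: "(\<forall>i::6. P i) \<longleftrightarrow> P 1 \<and> P 2 \<and> P 3 \<and> P 4 \<and> P 5 \<and> P 6"
  by (metis exhaust_6)

lemma sum_6: "sum f (UNIV::6 set) = f 1 + f 2 + f 3 + f 4 + f 5 + f 6"
  unfolding UNIV_6 by (simp add: ac_simps)

lemma vector_6 [simp]:
  "(vector [a, b, c, d, e, f] :: ('a::zero)^6) $ 1 = a"
  "(vector [a, b, c, d, e, f] :: ('a::zero)^6) $ 2 = b"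
  "(vector [a, b, c, d, e, f] :: ('a::zero)^6) $ 3 = c"
  "(vector [a, b, c, d, e, f] :: ('a::zero)^6) $ 4 = d"
  "(vector [a, b, c, d, e, f] :: ('a::zero)^6) $ 5 = e"
  "(vector [a, b, c, d, e, f] :: ('a::zero)^6) $ 6 = f"
  unfolding vector_def by simp_all

lemma block_rotation_add:
  "block_rotation a b c ** block_rotation a' b' c' = block_rotation (a + a') (b + b') (c + c')"
  by (simp add: vec_eq_iff forall_6 matrix_matrix_mult_def sum_6 block_rotation_def
        cos_add sin_add)

lemma orthogonal_block_rotation: "orthogonal_matrix (block_rotation a b c)"
proof -
  have "transpose (block_rotation a b c) = block_rotation (- a) (- b) (- c)"
    by (simp add: vec_eq_iff forall_6 transpose_def block_rotation_def)
  moreover have "block_rotation 0 0 0 = mat 1"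
    by (simp add: vec_eq_iff forall_6 mat_def block_rotation_def)
  ultimately show ?thesis
    by (simp add: orthogonal_matrix block_rotation_add)
qed

lemma lens_generator_in_special_orthogonal_group:
  "lens_generator q s\<^sub>1 s\<^sub>2 s\<^sub>3 \<in> carrier special_orthogonal_group"
proof -
  have "det (block_rotation a b c) = 1" for a b c
  proof -
    let ?h = "block_rotation (a/2) (b/2) (c/2)"
    have "det (block_rotation a b c) = det ?h * det ?h"
      by (simp add: block_rotation_add flip: det_mul)
    then show ?thesis
      using det_orthogonal_matrix[OF orthogonal_block_rotation, of "a/2" "b/2" "c/2"] by auto
  qed
  then show ?thesis
    by (simp add: special_orthogonal_group_def lens_generator_def orthogonal_block_rotation)
qed

end

theory Submission
  imports Defs
begin

text \<open>The 3-sphere of unit vectors in \<open>\<complex>\<^sup>2\<close> is a group, so maps into it can be multiplied pointwise. The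
  equivariant map \<open>(z\<^sub>1, z\<^sub>2) \<mapsto> (z\<^sub>1\<^sup>m, z\<^sub>2\<^sup>n)\<close> (with moduli kept) has degree \<open>m n\<close>; when \<open>m n = 1 + q c k\<close> it is
  corrected to degree one by multiplying with the inverse \<open>k\<close>-th power of \<open>(z\<^sub>1\<^sup>q, z\<^sub>2\<^sup>c)\<close>, which is
  equivariant for the conjugation action. An explicit homotopy shows that \<open>(z\<^sub>1\<^sup>a, z\<^sub>2\<^sup>b)\<close> is homotopic to the
  group power \<open>z\<^sup>a\<^sup>b\<close>, so the corrected map is homotopic to the identity. An equivariant Whitehead
  argument for free actions of cyclic groups then makes it an equivariant homotopy equivalence, and
  joining with the identity of a circle gives
  \<open>L(q; s\<^sub>1, s\<^sub>2, s\<^sub>3) \<simeq> L(q; a\<^sub>1, a\<^sub>2, s\<^sub>3)\<close> whenever \<open>a\<^sub>1 a\<^sub>2 \<equiv> s\<^sub>1 s\<^sub>2 (mod q)\<close>. Two such exchanges connect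
  any two parameter triples whose products differ by a cube \<open>k\<^sup>3\<close> modulo \<open>q\<close>; here
  \<open>k = 1 + a r t\<close> with \<open>3 a \<equiv> 8 (mod r)\<close>.\<close>

section \<open>Homotopies between maps into spheres\<close>

lemma homotopic_with_canonI:
  fixes h :: "real \<times> 'a::topological_space \<Rightarrow> 'b::topological_space"
  assumes "continuous_on ({0..1} \<times> S) h" "\<And>t x. t \<in> {0..1} \<Longrightarrow> x \<in> S \<Longrightarrow> h (t, x) \<in> T"
    "\<And>x. h (0, x) = f x" "\<And>x. h (1, x) = g x" "\<And>t. t \<in> {0..1} \<Longrightarrow> P (\<lambda>x. h (t, x))"
  shows "homotopic_with_canon P S T f g"
  unfolding homotopic_with_def
proof (intro exI conjI allI ballI)
  show "continuous_map (prod_topology (top_of_set {0..1}) (top_of_set S)) (top_of_set T) h"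
    using assms(1,2) by auto
qed (use assms in auto)

lemma homotopic_with_canonE:
  assumes "homotopic_with_canon P S T f g"
  obtains h :: "real \<times> 'a::topological_space \<Rightarrow> 'b::topological_space"
    where "continuous_on ({0..1} \<times> S) h" "\<And>t x. t \<in> {0..1} \<Longrightarrow> x \<in> S \<Longrightarrow> h (t, x) \<in> T"
    "\<And>x. h (0, x) = f x" "\<And>x. h (1, x) = g x" "\<And>t. t \<in> {0..1} \<Longrightarrow> P (\<lambda>x. h (t, x))"
proof -
  obtain h :: "real \<times> 'a \<Rightarrow> 'b" where h: "continuous_map (prod_topology (top_of_set {0..1}) (top_of_set S)) (top_of_set T) h"
    "\<forall>x. h (0, x) = f x" "\<forall>x. h (1, x) = g x" "\<forall>t\<in>{0..1}. P (\<lambda>x. h (t, x))"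
    using assms unfolding homotopic_with_def by blast
  have *: "h ` ({0..1} \<times> S) \<subseteq> T" "continuous_on ({0..1} \<times> S) h"
    using h(1) by auto
  show thesis
    by (rule that[of h]) (use h(2-) * in auto)
qed

text \<open>The segment from \<open>f x\<close> to \<open>g x\<close> meets the origin only if the
  two unit vectors are antipodal; otherwise the straight-line homotopy can be normalised.\<close>

lemma homotopic_non_antipodal:
  fixes f g :: "'a::topological_space \<Rightarrow> 'b::real_normed_vector"
  assumes f: "continuous_on S f" "\<And>x. x \<in> S \<Longrightarrow> norm (f x) = 1"
    and g: "continuous_on S g" "\<And>x. x \<in> S \<Longrightarrow> norm (g x) = 1"
    and neq: "\<And>x. x \<in> S \<Longrightarrow> f x \<noteq> - g x"
  shows "homotopic_with_canon (\<lambda>_. True) S (sphere 0 1) f g"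
proof -
  let ?h = "\<lambda>z. (1 - fst z) *\<^sub>R f (snd z) + fst z *\<^sub>R g (snd z)"
  have nz: "(1 - t) *\<^sub>R f x + t *\<^sub>R g x \<noteq> 0" if "t \<in> {0..1}" "x \<in> S" for t x
  proof
    assume 0: "(1 - t) *\<^sub>R f x + t *\<^sub>R g x = 0"
    have nn: "norm (f x) = 1" "norm (g x) = 1" using f g that by auto
    from 0 have eq: "(1 - t) *\<^sub>R f x = - (t *\<^sub>R g x)"
      by (simp add: eq_neg_iff_add_eq_0)
    then have "norm ((1 - t) *\<^sub>R f x) = norm (t *\<^sub>R g x)"
      by (metis norm_minus_cancel)
    then have "t = 1/2" using nn that by auto
    with eq have "(1/2::real) *\<^sub>R f x = (1/2::real) *\<^sub>R (- g x)" by simp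
    then have "f x = - g x"
      by (subst (asm) scaleR_cancel_left) simp
    then show False using neq[OF that(2)] by simp
  qed
  have c: "continuous_on ({0..1} \<times> S) ?h"
    by (intro continuous_intros continuous_on_compose2[OF f(1)] continuous_on_compose2[OF g(1)]) auto
  have "homotopic_with_canon (\<lambda>_. True) S (sphere 0 1) (\<lambda>x. ?h (0, x) /\<^sub>R norm (?h (0, x))) (\<lambda>x. ?h (1, x) /\<^sub>R norm (?h (1, x)))"
  proof (rule homotopic_with_canonI[where h = "\<lambda>z. ?h z /\<^sub>R norm (?h z)"])
    show "continuous_on ({0..1} \<times> S) (\<lambda>z. ?h z /\<^sub>R norm (?h z))"
      by (intro continuous_on_scaleR continuous_on_inverse continuous_on_norm c) (use nz in force)
  qed (use nz in auto)
  then show ?thesis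
    by (rule homotopic_with_eq) (simp_all add: f g)
qed

section \<open>The group structure of the 3-sphere\<close>

abbreviation S3 :: "(complex \<times> complex) set" where
  "S3 \<equiv> sphere 0 1"

text \<open>Quaternion multiplication: \<open>(a, b)\<close> stands for \<open>a + b j\<close>, with
  \<open>j z = cnj z j\<close>.\<close>

definition qmul :: "complex \<times> complex \<Rightarrow> complex \<times> complex \<Rightarrow> complex \<times> complex" where
  "qmul x y = (fst x * fst y - snd x * cnj (snd y), fst x * snd y + snd x * cnj (fst y))"

text \<open>Quaternion conjugation, which inverts elements only on the unit sphere.\<close>

definition qinv :: "complex \<times> complex \<Rightarrow> complex \<times> complex" where
  "qinv x = (cnj (fst x), - snd x)"

lemma norm_pair_power2: "(norm (x :: complex \<times> complex))\<^sup>2 = (cmod (fst x))\<^sup>2 + (cmod (snd x))\<^sup>2"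
  by (simp add: norm_prod_def)

text \<open>Euler's four-square identity.\<close>

lemma norm_qmul [simp]: "norm (qmul x y) = norm x * norm y"
proof -
  have "(norm (qmul x y))\<^sup>2 = (norm x * norm y)\<^sup>2"
    unfolding norm_pair_power2 power_mult_distrib qmul_def
    by (simp add: cmod_power2) algebra
  then show ?thesis
    by (simp add: power2_eq_iff_nonneg)
qed

lemma norm_qinv [simp]: "norm (qinv x) = norm x"
  by (simp add: norm_prod_def qinv_def)

lemma qmul_assoc: "qmul (qmul x y) z = qmul x (qmul y z)"
  by (simp add: qmul_def algebra_simps)

lemma qmul_one [simp]: "qmul (1, 0) x = x" "qmul x (1, 0) = x"
  by (simp_all add: qmul_def)

text \<open>A polynomial form of the unit-norm condition, in which the inverse laws become ring
  identities.\<close>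

lemma norm_pair_eq_1_iff:
  "norm (x :: complex \<times> complex) = 1 \<longleftrightarrow> fst x * cnj (fst x) + snd x * cnj (snd x) = 1"
proof -
  have "norm x = 1 \<longleftrightarrow> (norm x)\<^sup>2 = 1"
    by (simp add: power2_eq_1_iff) (metis norm_not_less_zero zero_less_one neg_less_0_iff_less)
  also have "\<dots> \<longleftrightarrow> complex_of_real ((norm x)\<^sup>2) = 1"
    by (metis of_real_1 of_real_eq_iff)
  also have "complex_of_real ((norm x)\<^sup>2) = fst x * cnj (fst x) + snd x * cnj (snd x)"
    unfolding norm_pair_power2 by (simp only: of_real_add complex_norm_square)
  finally show ?thesis .
qed

lemma qmul_qinv [simp]:
  assumes "norm x = 1"
  shows "qmul x (qinv x) = (1, 0)" "qmul (qinv x) x = (1, 0)"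
  using assms by (auto simp: norm_pair_eq_1_iff qmul_def qinv_def algebra_simps)

lemma qmul_qinv_left [simp]:
  assumes "norm x = 1"
  shows "qmul (qinv x) (qmul x y) = y" "qmul x (qmul (qinv x) y) = y"
  using assms by (simp_all flip: qmul_assoc)

lemma continuous_on_qmul [continuous_intros]:
  "continuous_on S f \<Longrightarrow> continuous_on S g \<Longrightarrow> continuous_on S (\<lambda>x. qmul (f x) (g x))"
  unfolding qmul_def by (intro continuous_intros)

lemma continuous_on_qinv [continuous_intros]:
  "continuous_on S f \<Longrightarrow> continuous_on S (\<lambda>x. qinv (f x))"
  unfolding qinv_def by (intro continuous_intros)

primrec qpow :: "complex \<times> complex \<Rightarrow> nat \<Rightarrow> complex \<times> complex" where
  "qpow x 0 = (1, 0)"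
| "qpow x (Suc n) = qmul (qpow x n) x"

lemma norm_qpow [simp]: "norm (qpow x n) = norm x ^ n"
  by (induction n) (simp_all add: norm_prod_def[of "(1, 0)"] mult.commute)

lemma qpow_add: "qpow x (m + n) = qmul (qpow x m) (qpow x n)"
  by (induction n) (simp_all add: qmul_assoc)

lemma qpow_mult: "qpow x (m * n) = qpow (qpow x m) n"
  by (induction n) (simp_all add: qpow_add add.commute[of m])

lemma qpow_commute: "qmul x (qpow x n) = qmul (qpow x n) x"
  using qpow_add[of x 1 n] by simp

lemma qpow_qinv:
  assumes "norm x = 1"
  shows "qmul (qpow x n) (qpow (qinv x) n) = (1, 0)"
proof (induction n)
  case (Suc n)
  have "qmul (qpow x (Suc n)) (qpow (qinv x) (Suc n))
     = qmul (qpow x n) (qmul x (qmul (qinv x) (qpow (qinv x) n)))"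
    by (simp add: qmul_assoc qpow_commute)
  then show ?case
    using Suc assms by simp
qed simp

lemma continuous_on_qpow [continuous_intros]:
  "continuous_on S f \<Longrightarrow> continuous_on S (\<lambda>x. qpow (f x) n)"
  by (induction n) (auto intro!: continuous_on_qmul)

lemma homotopic_qmul:
  assumes "homotopic_with_canon (\<lambda>_. True) S S3 f f'" "homotopic_with_canon (\<lambda>_. True) S S3 g g'"
  shows "homotopic_with_canon (\<lambda>_. True) S S3 (\<lambda>x. qmul (f x) (g x)) (\<lambda>x. qmul (f' x) (g' x))"
proof -
  obtain h :: "real \<times> _ \<Rightarrow> _" where h: "continuous_on ({0..1} \<times> S) h" "\<And>t x. t \<in> {0..1} \<Longrightarrow> x \<in> S \<Longrightarrow> h (t, x) \<in> S3"
    "\<And>x. h (0, x) = f x" "\<And>x. h (1, x) = f' x"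
    using assms(1) by (elim homotopic_with_canonE) blast
  obtain k :: "real \<times> _ \<Rightarrow> _" where k: "continuous_on ({0..1} \<times> S) k" "\<And>t x. t \<in> {0..1} \<Longrightarrow> x \<in> S \<Longrightarrow> k (t, x) \<in> S3"
    "\<And>x. k (0, x) = g x" "\<And>x. k (1, x) = g' x"
    using assms(2) by (elim homotopic_with_canonE) blast
  show ?thesis
    by (rule homotopic_with_canonI[where h = "\<lambda>z. qmul (h z) (k z)"])
      (use h k in \<open>simp_all add: continuous_on_qmul\<close>)
qed

lemma homotopic_qinv:
  assumes "homotopic_with_canon (\<lambda>_. True) S S3 f f'"
  shows "homotopic_with_canon (\<lambda>_. True) S S3 (\<lambda>x. qinv (f x)) (\<lambda>x. qinv (f' x))"
proof -
  have "homotopic_with_canon (\<lambda>_. True) S S3 (qinv \<circ> f) (qinv \<circ> f')"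
    by (rule homotopic_with_compose_continuous_left[where Y = S3])
      (use assms in \<open>auto intro!: continuous_on_qinv continuous_on_id\<close>)
  then show ?thesis by (simp add: o_def)
qed

lemma homotopic_qpow:
  assumes "homotopic_with_canon (\<lambda>_. True) S S3 f f'"
  shows "homotopic_with_canon (\<lambda>_. True) S S3 (\<lambda>x. qpow (f x) n) (\<lambda>x. qpow (f' x) n)"
proof (induction n)
  case 0
  have "norm (1::complex, 0::complex) = 1" by (simp add: norm_prod_def)
  then show ?case by simp
qed (simp add: homotopic_qmul assms)

section \<open>The power maps of the join\<close>

text \<open>The factor \<open>cmod z\<close> makes the value at 0 equal to 0 for every exponent,
  including \<open>a = 0\<close>, where \<open>sgn z ^ a\<close> is 1.\<close>

definition circle_power :: "nat \<Rightarrow> complex \<Rightarrow> complex" where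
  "circle_power a z = of_real (cmod z) * sgn z ^ a"

lemma cmod_circle_power [simp]: "cmod (circle_power a z) = cmod z"
  by (auto simp: circle_power_def norm_mult norm_power norm_sgn)

lemma circle_power_1 [simp]: "circle_power (Suc 0) z = z"
  by (simp add: circle_power_def sgn_eq)

lemma circle_power_0 [simp]: "circle_power 0 z = of_real (cmod z)"
  by (simp add: circle_power_def)

lemma circle_power_mult:
  "cmod w = 1 \<Longrightarrow> circle_power a (w * z) = w ^ a * circle_power a z"
  by (simp add: circle_power_def norm_mult sgn_mult power_mult_distrib sgn_eq[of w])

text \<open>At 0 the preserved modulus forces the limit; elsewhere \<open>sgn\<close> is
  continuous.\<close>

lemma continuous_circle_power: "continuous_on UNIV (circle_power a)"
proof -
  have "isCont (circle_power a) z" for z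
  proof (cases "z = 0")
    case True
    have "(circle_power a \<longlongrightarrow> 0) (at 0)"
      by (rule tendsto_norm_zero_cancel) (simp add: tendsto_norm_zero)
    then show ?thesis
      by (simp add: isCont_def True circle_power_def)
  next
    case False
    then show ?thesis
      unfolding circle_power_def by (intro continuous_intros) auto
  qed
  then show ?thesis
    by (simp add: continuous_at_imp_continuous_on)
qed

definition join_power :: "nat \<Rightarrow> nat \<Rightarrow> complex \<times> complex \<Rightarrow> complex \<times> complex" where
  "join_power a b x = (circle_power a (fst x), circle_power b (snd x))"

lemma norm_join_power [simp]: "norm (join_power a b x) = norm x"
  by (simp add: join_power_def norm_prod_def)

lemma continuous_join_power [continuous_intros]:
  "continuous_on S f \<Longrightarrow> continuous_on S (\<lambda>x. join_power a b (f x))"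
  unfolding join_power_def
  by (intro continuous_on_Pair continuous_on_compose2[OF continuous_circle_power] continuous_on_fst continuous_on_snd) auto

text \<open>The number \<open>w\<close> is joined to 1 along the unit circle. Below this serves to
  absorb signs.\<close>

lemma homotopic_S3_rotate_snd:
  assumes "cmod w = 1"
  shows "homotopic_with_canon (\<lambda>_. True) S3 S3 (\<lambda>x. (fst x, snd x)) (\<lambda>x. (fst x, w * snd x))"
proof -
  obtain \<phi> where w: "w = cis \<phi>"
    using assms cis_Arg[of w] by (metis div_by_1 norm_zero of_real_1 sgn_eq zero_neq_one)
  show ?thesis
  proof (rule homotopic_with_canonI[where h = "\<lambda>z. (fst (snd z), cis (\<phi> * fst z) * snd (snd z))"])
    show "continuous_on ({0..1} \<times> S3) (\<lambda>z. (fst (snd z), cis (\<phi> * fst z) * snd (snd z)))"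
      by (intro continuous_on_Pair continuous_on_mult continuous_on_cis continuous_on_fst continuous_on_snd continuous_on_id continuous_on_const)
  qed (simp_all add: norm_prod_def norm_mult w)
qed

abbreviation homotopic_S3 (infix "\<sim>\<^sub>S" 50) where
  "f \<sim>\<^sub>S g \<equiv> homotopic_with_canon (\<lambda>_. True) S3 S3 f g"

text \<open>The first coordinate of \<open>join_power 0 b x\<close> is a modulus, so it never equals
  -1.\<close>

lemma join_power_0_homotopic: "join_power 0 b \<sim>\<^sub>S (\<lambda>x. (1, 0))"
proof (rule homotopic_non_antipodal)
  fix x :: "complex \<times> complex"
  show "join_power 0 b x \<noteq> - (1, 0)"
  proof
    assume "join_power 0 b x = - (1, 0)"
    then have "complex_of_real (cmod (fst x)) = complex_of_real (-1)"
      by (simp add: join_power_def)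
    then have "cmod (fst x) = - 1"
      by (simp only: of_real_eq_iff)
    then show False
      using norm_ge_zero[of "fst x"] by linarith
  qed
qed (simp_all add: continuous_join_power continuous_on_const)

text \<open>On the set where the two maps could be antipodal one has \<open>fst x = - cmod (fst x)\<close>, and there
  the loop \<open>sgn (fst x) ^ a\<close> is the constant \<open>(-1) ^ a\<close>.\<close>

lemma join_power_Suc_homotopic:
  "join_power (Suc a) b \<sim>\<^sub>S (\<lambda>x. qmul (join_power a b x) (join_power 1 b x))"
proof -
  \<comment> \<open>\<open>K\<close> is the factor that turns \<open>join_power a b\<close> into
    \<open>join_power (Suc a) b\<close>, and \<open>Q\<close> is its instance for
    \<open>a = 0\<close>. As \<open>join_power 0 b\<close> is null-homotopic, \<open>Q\<close> is
    homotopic to \<open>join_power 1 b\<close>, so it remains to compare \<open>K\<close> with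
    \<open>Q\<close>.\<close>
  define Q where "Q = (\<lambda>x. qmul (qinv (join_power 0 b x)) (join_power 1 b x))"
  define K where "K = (\<lambda>x. qmul (qinv (join_power a b x)) (join_power (Suc a) b x))"
  have Q: "Q x = (of_real (cmod (fst x)) * fst x + of_real ((cmod (snd x))\<^sup>2),
      circle_power b (snd x) * (of_real (cmod (fst x)) - cnj (fst x)))" for x
    unfolding Q_def qmul_def qinv_def join_power_def
    by (simp add: algebra_simps flip: complex_norm_square)
  \<comment> \<open>This product does not depend on \<open>a\<close>, so \<open>K\<close> and
    \<open>Q\<close> have the same first coordinate.\<close>
  have "cnj (circle_power a z) * circle_power (Suc a) z = of_real (cmod z) * z" for z
  proof (cases "z = 0")
    case False
    then have "cnj (sgn z) * sgn z = 1"
      by (simp add: mult.commute[of "cnj _"] norm_sgn flip: complex_norm_square)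
    then have "(cnj (sgn z) * sgn z) ^ a = 1"
      by simp
    moreover have "cnj (circle_power a z) * circle_power (Suc a) z =
        of_real (cmod z) * (of_real (cmod z) * sgn z) * (cnj (sgn z) * sgn z) ^ a"
      by (simp only: circle_power_def complex_cnj_mult complex_cnj_power complex_cnj_complex_of_real
          power_mult_distrib power_Suc mult_ac)
    ultimately show ?thesis
      using False by (simp add: sgn_eq)
  qed (simp add: circle_power_def)
  then have K: "K x = (of_real (cmod (fst x)) * fst x + of_real ((cmod (snd x))\<^sup>2),
      circle_power b (snd x) * (cnj (circle_power a (fst x)) - cnj (circle_power (Suc a) (fst x))))" for x
    unfolding K_def qmul_def qinv_def join_power_def
    by (simp add: algebra_simps flip: complex_norm_square)
  have cQ: "continuous_on S3 Q" and cK: "continuous_on S3 K"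
    unfolding Q_def K_def by (intro continuous_intros)+
  have nQ: "norm (Q x) = 1" and nK: "norm (K x) = 1" if "x \<in> S3" for x
    using that by (simp_all add: Q_def K_def)
  \<comment> \<open>The sign matches the second coordinates of \<open>K\<close> and \<open>Q\<close>
    at the only points where antipodality has to be excluded.\<close>
  have "Q \<sim>\<^sub>S (\<lambda>x. (fst (Q x), (-1) ^ a * snd (Q x)))"
    using homotopic_with_compose_continuous_right[OF homotopic_S3_rotate_snd, of "(-1) ^ a" S3 Q] cQ nQ
    by (simp add: o_def norm_power Pi_iff)
  moreover have "K \<sim>\<^sub>S (\<lambda>x. (fst (Q x), (-1) ^ a * snd (Q x)))"
  proof (rule homotopic_non_antipodal)
    show "continuous_on S3 (\<lambda>x. (fst (Q x), (-1) ^ a * snd (Q x)))"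
      by (intro continuous_intros cQ)
    fix x assume x: "x \<in> S3"
    show "norm (fst (Q x), (-1) ^ a * snd (Q x)) = 1"
      using nQ[OF x] by (simp add: norm_prod_def norm_mult norm_power)
    show "K x \<noteq> - (fst (Q x), (-1) ^ a * snd (Q x))"
    proof
      define r s where "r = cmod (fst x)" and "s = cmod (snd x)"
      assume eq: "K x = - (fst (Q x), (-1) ^ a * snd (Q x))"
      have rs: "r\<^sup>2 + s\<^sup>2 = 1"
        using x norm_pair_power2[of x] by (simp add: r_def s_def)
      \<comment> \<open>Equal first coordinates of antipodal points vanish; this makes
        \<open>fst x\<close> the negative real number \<open>- r\<close>.\<close>
      have "fst (K x) = fst (Q x)"
        by (simp add: K Q)
      moreover have "fst (K x) = - fst (Q x)"
        using eq by simp
      ultimately have "fst (Q x) = 0"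
        by simp
      then have "complex_of_real r * fst x + of_real (s\<^sup>2) = 0"
        by (simp add: Q r_def s_def)
      then have 1: "complex_of_real r * fst x = - of_real (s\<^sup>2)"
        by (simp add: eq_neg_iff_add_eq_0)
      then have "cmod (complex_of_real r * fst x) = cmod (of_real (s\<^sup>2) :: complex)"
        by simp
      then have "r * r = s\<^sup>2"
        by (simp only: norm_mult norm_of_real) (simp add: r_def)
      moreover from this rs have r0: "r \<noteq> 0" and s0: "s \<noteq> 0"
        by (auto simp: power2_eq_square)
      ultimately have z: "fst x = - of_real r"
        using 1 by (simp add: power2_eq_square flip: of_real_mult)
          (metis mult_cancel_left mult_minus_right of_real_eq_0_iff of_real_mult)
      have "r > 0"
        using r0 by (simp add: r_def)
      then have "sgn (fst x) = - 1"
        using z by (simp add: sgn_eq)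
      then have cp: "circle_power n (fst x) = r * (-1) ^ n" for n
        by (simp add: circle_power_def r_def)
      have "snd (K x) = (-1) ^ a * (2 * r) * circle_power b (snd x)"
        by (simp add: K cp)
      moreover have "snd (Q x) = (2 * r) * circle_power b (snd x)"
        using z by (simp add: Q) (simp add: r_def)
      ultimately have "(-1) ^ a * (2 * r) * circle_power b (snd x) = 0"
        using eq by (simp add: prod_eq_iff)
      moreover have "cmod (circle_power b (snd x)) \<noteq> 0"
        using s0 by (simp add: s_def)
      ultimately show False
        using r0 by auto
    qed
  qed (use nK in \<open>simp_all add: cK\<close>)
  ultimately have "K \<sim>\<^sub>S Q"
    using homotopic_with_symD homotopic_with_trans by blast
  moreover have "Q \<sim>\<^sub>S (\<lambda>x. qmul (qinv (1, 0)) (join_power 1 b x))"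
    unfolding Q_def by (intro homotopic_qmul homotopic_qinv join_power_0_homotopic)
      (simp add: continuous_join_power Pi_iff)
  ultimately have "K \<sim>\<^sub>S join_power 1 b"
    by (auto simp: qinv_def intro: homotopic_with_trans)
  then have "(\<lambda>x. qmul (join_power a b x) (K x)) \<sim>\<^sub>S (\<lambda>x. qmul (join_power a b x) (join_power 1 b x))"
    by (intro homotopic_qmul) (simp_all add: continuous_join_power Pi_iff)
  then show ?thesis
    by (rule homotopic_with_eq) (simp_all add: K_def)
qed

text \<open>Each unit of the first exponent splits off one factor \<open>join_power 1 b\<close>;
  exponent 0 is the null-homotopic case.\<close>

lemma join_power_homotopic_qpow:
  "join_power a b \<sim>\<^sub>S (\<lambda>x. qpow (join_power 1 b x) a)"
proof (induction a)
  case 0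
  then show ?case by (simp add: join_power_0_homotopic)
next
  case (Suc a)
  have "(\<lambda>x. qmul (join_power a b x) (join_power 1 b x)) \<sim>\<^sub>S (\<lambda>x. qpow (join_power 1 b x) (Suc a))"
    using Suc by (auto intro!: homotopic_qmul simp: continuous_join_power Pi_iff)
  then show ?case
    using join_power_Suc_homotopic homotopic_with_trans by blast
qed

text \<open>If \<open>(z2, z1)\<close> and \<open>(z1, - z2)\<close> were antipodal, then
  \<open>z2 = - z1\<close> and \<open>z1 = z2\<close>, so both would vanish. The remaining sign is
  removed by a rotation.\<close>

lemma swap_homotopic_id: "(\<lambda>x. (snd x, fst x)) \<sim>\<^sub>S (\<lambda>x. x)"
proof -
  have "(\<lambda>x. (snd x, fst x)) \<sim>\<^sub>S (\<lambda>x. (fst x, - snd x))"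
    by (rule homotopic_non_antipodal)
      (auto intro!: continuous_on_Pair continuous_on_minus continuous_on_fst continuous_on_snd continuous_on_id
        simp: norm_prod_def add.commute)
  moreover have "(\<lambda>x. (fst x, snd x)) \<sim>\<^sub>S (\<lambda>x. (fst x, - snd x))"
    using homotopic_S3_rotate_snd[of "-1"] by simp
  ultimately show ?thesis
    unfolding prod.collapse using homotopic_with_symD homotopic_with_trans by blast
qed

text \<open>This replaces a comparison of degrees. Composing with the coordinate swap on both sides
  carries the formula for \<open>join_power b 1\<close> over to \<open>join_power 1 b\<close>; the
  exponent \<open>a\<close> is then a group power.\<close>

lemma join_power_homotopic: "join_power a b \<sim>\<^sub>S (\<lambda>x. qpow x (a * b))"
proof -
  let ?\<sigma> = "\<lambda>x :: complex \<times> complex. (snd x, fst x)"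
  have swap: "continuous_on S3 ?\<sigma>" "?\<sigma> \<in> S3 \<rightarrow> S3"
    by (auto intro!: continuous_on_Pair continuous_on_fst continuous_on_snd continuous_on_id
        simp: norm_prod_def add.commute)
  have id: "join_power 1 1 = (\<lambda>x. x)"
    by (simp add: join_power_def fun_eq_iff)
  have "join_power b 1 \<sim>\<^sub>S (\<lambda>x. qpow x b)"
    using join_power_homotopic_qpow[of b 1] by (simp only: id)
  then have 1: "(\<lambda>x. join_power b 1 (?\<sigma> x)) \<sim>\<^sub>S (\<lambda>x. qpow x b)"
    using homotopic_compose[OF swap_homotopic_id] by (fastforce simp: o_def)
  have "(\<lambda>x. ?\<sigma> (join_power b 1 (?\<sigma> x))) \<sim>\<^sub>S (\<lambda>x. qpow x b)"
    using homotopic_compose[OF 1 swap_homotopic_id] by (simp add: o_def)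
  then have "join_power 1 b \<sim>\<^sub>S (\<lambda>x. qpow x b)"
    by (rule homotopic_with_eq) (simp_all add: join_power_def)
  then have "(\<lambda>x. qpow (join_power 1 b x) a) \<sim>\<^sub>S (\<lambda>x. qpow (qpow x b) a)"
    by (rule homotopic_qpow)
  with join_power_homotopic_qpow show ?thesis
    by (simp add: mult.commute[of a] qpow_mult) (rule homotopic_with_trans)
qed

section \<open>Extension of homotopies and of equivariant maps\<close>

text \<open>The data on \<open>B\<close> extend to a neighbourhood because \<open>U\<close> is an
  ANR. The tube lemma finds \<open>{0..1} \<times> W\<close> inside it, and a Urysohn function
  \<open>a\<close> that is 1 on \<open>L\<close> and 0 off \<open>W\<close> slows time so that
  \<open>(t * a y, y)\<close> stays in the neighbourhood.\<close>

lemma homotopy_extension: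
  fixes u :: "'a::euclidean_space \<Rightarrow> 'b::euclidean_space" and h :: "real \<times> 'a \<Rightarrow> 'b"
  assumes U: "ANR U" and cl: "closedin (top_of_set K) L"
    and u: "continuous_on K u" "\<And>y. y \<in> K \<Longrightarrow> u y \<in> U"
    and h: "continuous_on ({0..1} \<times> L) h" "\<And>t y. t \<in> {0..1} \<Longrightarrow> y \<in> L \<Longrightarrow> h (t, y) \<in> U"
    and h0: "\<And>y. y \<in> L \<Longrightarrow> h (0, y) = u y"
  obtains k where "continuous_on ({0..1} \<times> K) k" "\<And>t y. t \<in> {0..1} \<Longrightarrow> y \<in> K \<Longrightarrow> k (t, y) \<in> U"
    "\<And>y. y \<in> K \<Longrightarrow> k (0, y) = u y" "\<And>t y. t \<in> {0..1} \<Longrightarrow> y \<in> L \<Longrightarrow> k (t, y) = h (t, y)"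
proof -
  let ?I = "{0..1::real}"
  have "L \<subseteq> K" using cl closedin_imp_subset by blast
  define B where "B = ?I \<times> L \<union> {0} \<times> K"
  define b where "b = (\<lambda>z. if snd z \<in> L then h z else u (snd z))"
  have cI: "closedin (top_of_set (?I \<times> K)) (?I \<times> L)" and c0: "closedin (top_of_set (?I \<times> K)) ({0} \<times> K)"
    by (auto intro!: closedin_Times cl simp: closedin_self)
  then have cB: "closedin (top_of_set (?I \<times> K)) B"
    unfolding B_def by (rule closedin_Un)
  then have sub: "B \<subseteq> ?I \<times> K" using closedin_imp_subset by blast
  have "continuous_on B (\<lambda>z. if snd z \<in> L then h z else u (snd z))"
    unfolding B_def
  proof (rule continuous_on_cases_local)
    show "closedin (top_of_set (?I \<times> L \<union> {0} \<times> K)) (?I \<times> L)"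
      "closedin (top_of_set (?I \<times> L \<union> {0} \<times> K)) ({0} \<times> K)"
      using closedin_subset_trans[OF cI _ sub] closedin_subset_trans[OF c0 _ sub] by (auto simp: B_def)
    show "continuous_on ({0} \<times> K) (\<lambda>z. u (snd z))"
      by (intro continuous_on_compose2[OF u(1)] continuous_on_snd continuous_on_id) auto
  qed (use h h0 in auto)
  then have "continuous_on B b" by (simp add: b_def)
  moreover have "b \<in> B \<rightarrow> U"
    using u h \<open>L \<subseteq> K\<close> by (auto simp: B_def b_def)
  ultimately obtain V b' where "B \<subseteq> V" and V: "openin (top_of_set (?I \<times> K)) V"
    and b': "continuous_on V b'" "b' \<in> V \<rightarrow> U" "\<And>x. x \<in> B \<Longrightarrow> b' x = b x"
    using ANR_imp_absolute_neighbourhood_extensor[OF U _ _ cB] by metis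
  obtain W where W: "openin (top_of_set K) W" "L \<subseteq> W" "?I \<times> W \<subseteq> V"
    by (rule tube_lemma_gen[of ?I L K V]) (use \<open>B \<subseteq> V\<close> V \<open>L \<subseteq> K\<close> in \<open>auto simp: B_def\<close>)
  have "closedin (top_of_set K) (K - W)"
    using W(1) by (simp add: openin_closedin_eq)
  moreover have "L \<inter> (K - W) = {}" using W by auto
  ultimately obtain a :: "'a \<Rightarrow> real" where a: "continuous_on K a" "\<And>x. x \<in> K \<Longrightarrow> a x \<in> closed_segment 1 0"
     "\<And>x. x \<in> L \<Longrightarrow> a x = 1" "\<And>x. x \<in> K - W \<Longrightarrow> a x = 0"
    using Urysohn_local[OF cl] by metis
  have a01: "0 \<le> a x \<and> a x \<le> 1" if "x \<in> K" for x
    using a(2)[OF that] by (auto simp: closed_segment_eq_real_ivl)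
  have inV: "(t * a y, y) \<in> V" if "t \<in> ?I" "y \<in> K" for t y
  proof (cases "y \<in> W")
    case True
    then have "(t * a y, y) \<in> ?I \<times> W"
      using that a01[of y] by (auto simp: mult_le_one)
    then show ?thesis using W by blast
  next
    case False
    then have "(t * a y, y) \<in> B" using a that by (auto simp: B_def)
    then show ?thesis using \<open>B \<subseteq> V\<close> by blast
  qed
  show ?thesis
  proof (rule that[of "\<lambda>z. b' (fst z * a (snd z), snd z)"])
    show "continuous_on (?I \<times> K) (\<lambda>z. b' (fst z * a (snd z), snd z))"
      by (intro continuous_on_compose2[OF b'(1)] continuous_on_Pair continuous_on_mult continuous_on_fst
          continuous_on_snd continuous_on_id continuous_on_compose2[OF a(1)]) (use inV in auto)
  next
    fix y assume "y \<in> K"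
    then show "b' (fst (0, y) * a (snd (0, y)), snd (0, y)) = u y"
      using b'(3)[of "(0, y)"] h0 by (simp add: B_def b_def)
  next
    fix t y assume "t \<in> ?I" "y \<in> L"
    then show "b' (fst (t, y) * a (snd (t, y)), snd (t, y)) = h (t, y)"
      using b'(3)[of "(t, y)"] a(3) by (simp add: B_def b_def)
  qed (use inV b'(2) in auto)
qed

section \<open>Equivariant sections over a free action of a finite cyclic group\<close>

locale free_cyclic_action =
  fixes S :: "'a::metric_space set" and \<gamma> :: "'a \<Rightarrow> 'a" and q :: nat
  assumes compact: "compact S" and continuous: "continuous_on S \<gamma>"
    and closed_under: "\<And>x. x \<in> S \<Longrightarrow> \<gamma> x \<in> S"
    and period: "\<And>x. x \<in> S \<Longrightarrow> (\<gamma> ^^ q) x = x"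
    and free: "\<And>i x. 0 < i \<Longrightarrow> i < q \<Longrightarrow> x \<in> S \<Longrightarrow> (\<gamma> ^^ i) x \<noteq> x"
    and q_pos: "q > 0"
begin

lemma funpow_closed: "x \<in> S \<Longrightarrow> (\<gamma> ^^ i) x \<in> S"
  by (induction i) (simp_all add: closed_under)

lemma continuous_funpow: "continuous_on S (\<gamma> ^^ i)"
proof (induction i)
  case (Suc i)
  then show ?case
    unfolding funpow.simps
    by (intro continuous_on_compose continuous_on_subset[OF continuous]) (auto simp: funpow_closed)
qed (simp add: continuous_on_id)

text \<open>Inverses in the cyclic group are the complementary powers of the generator.\<close>

lemma funpow_cancel:
  assumes "x \<in> S" "i \<le> q"
  shows "(\<gamma> ^^ (q - i)) ((\<gamma> ^^ i) x) = x" "(\<gamma> ^^ i) ((\<gamma> ^^ (q - i)) x) = x"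
proof -
  have "(\<gamma> ^^ (q - i + i)) x = x" "(\<gamma> ^^ (i + (q - i))) x = x"
    using assms period by simp_all
  then show "(\<gamma> ^^ (q - i)) ((\<gamma> ^^ i) x) = x" "(\<gamma> ^^ i) ((\<gamma> ^^ (q - i)) x) = x"
    by (simp_all only: funpow_add o_apply)
qed

text \<open>On the union of the translates of such a set, an equivariant map amounts to an arbitrary
  map on the set itself.\<close>

definition small :: "'a set \<Rightarrow> bool" where
  "small K \<longleftrightarrow> closed K \<and> K \<subseteq> S \<and> (\<forall>i. 0 < i \<and> i < q \<longrightarrow> (\<gamma> ^^ i) ` K \<inter> K = {})"

text \<open>A nontrivial power moves \<open>x\<close> by some \<open>d > 0\<close>, and by
  continuity it moves points near \<open>x\<close> out of the ball of radius \<open>d / 2\<close>.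
  Only finitely many powers have to be considered.\<close>

lemma small_cball:
  assumes "x \<in> S"
  obtains e where "e > 0" "small (cball x e \<inter> S)"
proof -
  have "\<exists>e>0. (\<gamma> ^^ i) ` (cball x e \<inter> S) \<inter> (cball x e \<inter> S) = {}" if "0 < i" "i < q" for i
  proof -
    define d where "d = dist ((\<gamma> ^^ i) x) x"
    have "d > 0" using free that assms by (simp add: d_def)
    then obtain \<delta> where \<delta>: "\<delta> > 0" "\<And>y. y \<in> S \<Longrightarrow> dist y x < \<delta> \<Longrightarrow> dist ((\<gamma> ^^ i) y) ((\<gamma> ^^ i) x) < d / 2"
      using continuous_funpow[of i] assms unfolding continuous_on_iff by (metis half_gt_zero)
    show ?thesis
    proof (intro exI conjI)
      show "min (\<delta> / 2) (d / 2) > 0" using \<delta> \<open>d > 0\<close> by simp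
      show "(\<gamma> ^^ i) ` (cball x (min (\<delta> / 2) (d / 2)) \<inter> S) \<inter> (cball x (min (\<delta> / 2) (d / 2)) \<inter> S) = {}"
      proof (rule ccontr)
        assume "\<not> ?thesis"
        then obtain y where y: "y \<in> S" "dist x y \<le> \<delta> / 2" "dist x ((\<gamma> ^^ i) y) \<le> d / 2" by auto
        have "dist y x < \<delta>"
          using y(2) \<delta>(1) unfolding dist_commute[of y x] by linarith
        then have "dist ((\<gamma> ^^ i) y) ((\<gamma> ^^ i) x) < d / 2"
          using \<delta>(2) y(1) by blast
        moreover have "d \<le> dist ((\<gamma> ^^ i) y) ((\<gamma> ^^ i) x) + dist x ((\<gamma> ^^ i) y)"
          unfolding d_def by (metis dist_commute dist_triangle add.commute)
        ultimately show False using y(3) by simp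
      qed
    qed
  qed
  then obtain e where e: "\<And>i. 0 < i \<Longrightarrow> i < q \<Longrightarrow> e i > 0 \<and> (\<gamma> ^^ i) ` (cball x (e i) \<inter> S) \<inter> (cball x (e i) \<inter> S) = {}"
    by metis
  \<comment> \<open>The inserted 1 keeps the minimum defined when \<open>q = 1\<close> and there is
    no nontrivial power.\<close>
  define m where "m = Min (insert 1 (e ` {0<..<q}))"
  have "m > 0" unfolding m_def by (subst Min_gr_iff) (use e in auto)
  have le: "m \<le> e i" if "0 < i" "i < q" for i
    unfolding m_def using that by (intro Min_le) auto
  have "small (cball x m \<inter> S)"
    unfolding small_def
  proof (intro conjI allI impI)
    show "closed (cball x m \<inter> S)" using compact by (simp add: compact_imp_closed closed_Int)
    fix i assume i: "0 < i \<and> i < q"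
    then have "cball x m \<inter> S \<subseteq> cball x (e i) \<inter> S" using le[of i] by auto
    then show "(\<gamma> ^^ i) ` (cball x m \<inter> S) \<inter> (cball x m \<inter> S) = {}" using e[of i] i by blast
  qed simp
  with \<open>m > 0\<close> show thesis by (rule that)
qed

text \<open>Open balls give the finite subcover; the closed balls are kept because gluing needs
  closed pieces.\<close>

lemma finite_small_cover:
  obtains \<K> where "finite \<K>" "\<And>K. K \<in> \<K> \<Longrightarrow> small K" "\<Union>\<K> = S"
proof -
  obtain e where e: "\<And>x. x \<in> S \<Longrightarrow> e x > 0 \<and> small (cball x (e x) \<inter> S)"
  proof -
    have "\<forall>x\<in>S. \<exists>e>0. small (cball x e \<inter> S)"
      using small_cball by blast
    then show thesis
      using that by metis
  qed
  have "S \<subseteq> (\<Union>x\<in>S. ball x (e x))" using e by force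
  then obtain D where D: "D \<subseteq> S" "finite D" "S \<subseteq> (\<Union>x\<in>D. ball x (e x))"
    using compactE_image[OF compact, of S "\<lambda>x. ball x (e x)"] by auto
  show thesis
  proof (rule that[of "(\<lambda>x. cball x (e x) \<inter> S) ` D"])
    have "S \<subseteq> (\<Union>x\<in>D. cball x (e x))"
      by (rule order_trans[OF D(3)]) (intro UN_mono order_refl ball_subset_cball)
    then show "\<Union>((\<lambda>x. cball x (e x) \<inter> S) ` D) = S" by blast
  next
    fix K assume "K \<in> (\<lambda>x. cball x (e x) \<inter> S) ` D"
    then show "small K" using D(1) e by blast
  qed (use D(2) in simp)
qed

text \<open>A section over \<open>S\<close> of a family of function spaces, given by the admissible functions
  \<open>T \<Rightarrow> 'c\<close> over each point, is built one translate-disjoint closed set at a time: it is extended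
  over such a set by the hypothesis, and then over the translates of the set by equivariance.\<close>

context
  fixes T :: "'d::metric_space set" and \<theta> :: "'c::metric_space \<Rightarrow> 'c"
    and Adm :: "'a \<Rightarrow> ('d \<Rightarrow> 'c) \<Rightarrow> bool"
  assumes T: "closed T"
    and \<theta>: "continuous_on UNIV \<theta>" "\<And>v. (\<theta> ^^ q) v = v"
    and Adm: "\<And>y p. y \<in> S \<Longrightarrow> Adm y p \<Longrightarrow> Adm (\<gamma> y) (\<lambda>t. \<theta> (p t))"
    and extend: "\<And>K L \<Lambda>. closed K \<Longrightarrow> K \<subseteq> S \<Longrightarrow> closed L \<Longrightarrow> L \<subseteq> K \<Longrightarrow> continuous_on (T \<times> L) \<Lambda> \<Longrightarrow>
      (\<And>y. y \<in> L \<Longrightarrow> Adm y (\<lambda>t. \<Lambda> (t, y))) \<Longrightarrow>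
      \<exists>\<Lambda>'. continuous_on (T \<times> K) \<Lambda>' \<and> (\<forall>y\<in>K. Adm y (\<lambda>t. \<Lambda>' (t, y))) \<and>
        (\<forall>t\<in>T. \<forall>y\<in>L. \<Lambda>' (t, y) = \<Lambda> (t, y))"
begin

text \<open>Closed domains allow gluing. Forward invariance suffices, since inverses are powers of
  the generator.\<close>

definition section_on :: "'a set \<Rightarrow> ('d \<times> 'a \<Rightarrow> 'c) \<Rightarrow> bool" where
  "section_on A \<Lambda> \<longleftrightarrow> closed A \<and> A \<subseteq> S \<and> \<gamma> ` A \<subseteq> A \<and> continuous_on (T \<times> A) \<Lambda> \<and>
     (\<forall>y\<in>A. Adm y (\<lambda>t. \<Lambda> (t, y))) \<and> (\<forall>t\<in>T. \<forall>y\<in>A. \<Lambda> (t, \<gamma> y) = \<theta> (\<Lambda> (t, y)))"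

lemma funpow_\<theta>: "i \<le> q \<Longrightarrow> (\<theta> ^^ i) ((\<theta> ^^ (q - i)) v) = v"
  by (metis \<theta>(2) comp_apply funpow_add le_add_diff_inverse)

lemma continuous_funpow_\<theta>: "continuous_on UNIV (\<theta> ^^ i)"
proof (induction i)
  case (Suc i)
  then show ?case
    unfolding funpow.simps
    by (intro continuous_on_compose continuous_on_subset[OF \<theta>(1)]) auto
qed (simp add: continuous_on_id)

lemma Adm_funpow: "y \<in> S \<Longrightarrow> Adm y p \<Longrightarrow> Adm ((\<gamma> ^^ i) y) (\<lambda>t. (\<theta> ^^ i) (p t))"
  by (induction i) (simp_all add: Adm funpow_closed)

lemma section_funpow:
  assumes "section_on A \<Lambda>" "t \<in> T" "y \<in> A"
  shows "(\<gamma> ^^ i) y \<in> A" "\<Lambda> (t, (\<gamma> ^^ i) y) = (\<theta> ^^ i) (\<Lambda> (t, y))"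
proof -
  show *: "(\<gamma> ^^ i) y \<in> A" for i
    using assms by (induction i) (auto simp: section_on_def)
  show "\<Lambda> (t, (\<gamma> ^^ i) y) = (\<theta> ^^ i) (\<Lambda> (t, y))"
    by (induction i) (use assms * in \<open>auto simp: section_on_def\<close>)
qed

text \<open>The extension over \<open>K\<close> is carried to the \<open>i\<close>-th translate by
  \<open>\<theta> ^^ i\<close>. Disjointness of the translates makes this unambiguous, and on
  \<open>A\<close> it agrees with the given section because that one is already equivariant.\<close>

lemma section_on_extend:
  assumes A: "section_on A \<Lambda>" and K: "small K"
  obtains A' \<Lambda>' where "section_on A' \<Lambda>'" "A \<subseteq> A'" "K \<subseteq> A'"
proof -
  have K': "closed K" "K \<subseteq> S" using K by (auto simp: small_def)
  have A': "closed A" "A \<subseteq> S" "continuous_on (T \<times> A) \<Lambda>" "\<And>y. y \<in> A \<Longrightarrow> \<gamma> y \<in> A"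
    "\<And>y. y \<in> A \<Longrightarrow> Adm y (\<lambda>t. \<Lambda> (t, y))" "\<And>t y. t \<in> T \<Longrightarrow> y \<in> A \<Longrightarrow> \<Lambda> (t, \<gamma> y) = \<theta> (\<Lambda> (t, y))"
    using A by (auto simp: section_on_def)
  have "continuous_on (T \<times> (A \<inter> K)) \<Lambda>"
    by (rule continuous_on_subset[OF A'(3)]) auto
  then obtain \<Lambda>1 where \<Lambda>1: "continuous_on (T \<times> K) \<Lambda>1" "\<And>y. y \<in> K \<Longrightarrow> Adm y (\<lambda>t. \<Lambda>1 (t, y))"
    "\<And>t y. t \<in> T \<Longrightarrow> y \<in> A \<Longrightarrow> y \<in> K \<Longrightarrow> \<Lambda>1 (t, y) = \<Lambda> (t, y)"
    using extend[of K "A \<inter> K" \<Lambda>] K' A' by (auto simp: closed_Int)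
  define G where "G i = (\<gamma> ^^ i) ` K" for i
  have GS: "G i \<subseteq> S" for i using K' funpow_closed by (auto simp: G_def)
  \<comment> \<open>A point in two translates would give a nontrivial power that maps a point of
    \<open>K\<close> into \<open>K\<close>.\<close>
  have G_unique: "i = j" if "i < q" "j < q" "y \<in> G i" "y \<in> G j" for i j y
  proof -
    have *: False if ij: "i < j" "j < q" and yi: "y \<in> G i" and yj: "y \<in> G j" for i j
    proof -
      obtain k k' where k: "k \<in> K" "k' \<in> K" "y = (\<gamma> ^^ i) k" "y = (\<gamma> ^^ j) k'"
        using yi yj by (auto simp: G_def)
      have "(\<gamma> ^^ i) k = (\<gamma> ^^ i) ((\<gamma> ^^ (j - i)) k')"
        using k ij by (metis comp_apply funpow_add le_add_diff_inverse less_imp_le)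
      then have "k = (\<gamma> ^^ (j - i)) k'"
        using funpow_cancel(1)[of k i] funpow_cancel(1)[of "(\<gamma> ^^ (j - i)) k'" i] k K' ij
        by (metis funpow_closed less_imp_le less_trans subsetD)
      then have "(\<gamma> ^^ (j - i)) ` K \<inter> K \<noteq> {}" using k by blast
      then show False using K ij unfolding small_def
        by (metis less_imp_diff_less zero_less_diff)
    qed
    show ?thesis using * that by (metis linorder_neqE_nat)
  qed
  define \<Lambda>' where "\<Lambda>' = (\<lambda>(t, y). if y \<in> A then \<Lambda> (t, y) else
      let i = (THE i. i < q \<and> y \<in> G i) in (\<theta> ^^ i) (\<Lambda>1 (t, (\<gamma> ^^ (q - i)) y)))"
  have onA: "\<Lambda>' (t, y) = \<Lambda> (t, y)" if "y \<in> A" for t y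
    using that by (simp add: \<Lambda>'_def)
  have off: "\<Lambda>' (t, y) = (\<theta> ^^ i) (\<Lambda>1 (t, (\<gamma> ^^ (q - i)) y))" if "i < q" "y \<in> G i" "y \<notin> A" for t y i
  proof -
    have "(THE i. i < q \<and> y \<in> G i) = i"
      using that G_unique by blast
    then show ?thesis using that by (simp add: \<Lambda>'_def)
  qed
  \<comment> \<open>The transported formula is valid on \<open>A\<close> too, so a single continuous
    expression describes \<open>\<Lambda>'\<close> on each closed translate.\<close>
  have onG: "\<Lambda>' (t, y) = (\<theta> ^^ i) (\<Lambda>1 (t, (\<gamma> ^^ (q - i)) y))" if "i < q" "y \<in> G i" "t \<in> T" for t y i
  proof (cases "y \<in> A")
    case True
    have "(\<gamma> ^^ (q - i)) y \<in> K"
      using that funpow_cancel(1) K' by (auto simp: G_def)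
    then show ?thesis
      using True onA[of y] that \<Lambda>1(3)[of t "(\<gamma> ^^ (q - i)) y"] section_funpow[OF A that(3) True] funpow_\<theta>[of i]
      by simp
  qed (use that off in blast)
  \<comment> \<open>From the last translate the generator returns to \<open>K\<close>: for
    \<open>Suc i = q\<close> the new index is 0.\<close>
  have Gstep: "\<exists>j<q. \<gamma> y \<in> G j \<and> (\<forall>t. (\<theta> ^^ j) (\<Lambda>1 (t, (\<gamma> ^^ (q - j)) (\<gamma> y))) =
       \<theta> ((\<theta> ^^ i) (\<Lambda>1 (t, (\<gamma> ^^ (q - i)) y))))" if i: "i < q" and y: "y \<in> G i" for i y
  proof -
    obtain k where k: "k \<in> K" "y = (\<gamma> ^^ i) k" using y by (auto simp: G_def)
    have kS: "k \<in> S" using k K' by auto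
    have k': "(\<gamma> ^^ (q - i)) y = k" using funpow_cancel(1) kS i k by simp
    have gy: "\<gamma> y = (\<gamma> ^^ Suc i) k" using k by simp
    show ?thesis
    proof (cases "Suc i < q")
      case True
      have "(\<gamma> ^^ (q - Suc i)) (\<gamma> y) = k" unfolding gy by (rule funpow_cancel(1)) (use kS True in auto)
      then show ?thesis using True k gy k' by (intro exI[of _ "Suc i"]) (auto simp: G_def)
    next
      case False
      then have "Suc i = q" using i by simp
      then have "\<gamma> y = k" using gy period kS by simp
      moreover have "\<theta> ((\<theta> ^^ i) v) = v" for v
        using \<theta>(2)[of v] \<open>Suc i = q\<close> by (metis comp_apply funpow.simps(2))
      ultimately show ?thesis
        using k k' kS period q_pos by (intro exI[of _ 0]) (auto simp: G_def)
    qed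
  qed
  define A2 where "A2 = A \<union> (\<Union>i<q. G i)"
  have "compact K"
    using compact_Int_closed[OF compact K'(1)] K'(2) by (simp add: inf.absorb2)
  then have closedG: "closed (G i)" for i
    unfolding G_def
    by (intro compact_imp_closed compact_continuous_image continuous_on_subset[OF continuous_funpow] K'(2))
  have step: "\<gamma> y \<in> A2 \<and> (\<forall>t\<in>T. \<Lambda>' (t, \<gamma> y) = \<theta> (\<Lambda>' (t, y))) \<and> Adm y (\<lambda>t. \<Lambda>' (t, y))" if yA2: "y \<in> A2" for y
  proof (cases "y \<in> A")
    case True
    then show ?thesis using A' onA by (simp add: A2_def)
  next
    case False
    then obtain i where i: "i < q" "y \<in> G i" using yA2 by (auto simp: A2_def)
    obtain j where j: "j < q" "\<gamma> y \<in> G j" "\<And>t. (\<theta> ^^ j) (\<Lambda>1 (t, (\<gamma> ^^ (q - j)) (\<gamma> y))) =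
       \<theta> ((\<theta> ^^ i) (\<Lambda>1 (t, (\<gamma> ^^ (q - i)) y)))"
      using Gstep[OF i] by blast
    obtain k where k: "k \<in> K" "y = (\<gamma> ^^ i) k" using i by (auto simp: G_def)
    then have "k \<in> S" using K' by auto
    then have "(\<gamma> ^^ (q - i)) y = k" using funpow_cancel(1) i k by simp
    then have "(\<lambda>t. \<Lambda>' (t, y)) = (\<lambda>t. (\<theta> ^^ i) (\<Lambda>1 (t, k)))"
      using off[OF i False] by simp
    then have "Adm y (\<lambda>t. \<Lambda>' (t, y))"
      using Adm_funpow[OF \<open>k \<in> S\<close> \<Lambda>1(2)[OF k(1)]] k by simp
    then show ?thesis using i j onG by (auto simp: A2_def)
  qed
  have contG: "continuous_on (T \<times> G i) \<Lambda>'" if "i < q" for i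
  proof -
    have "continuous_on (T \<times> G i) (\<lambda>z. (\<theta> ^^ i) (\<Lambda>1 (fst z, (\<gamma> ^^ (q - i)) (snd z))))"
    proof (intro continuous_on_compose2[OF continuous_funpow_\<theta>] continuous_on_compose2[OF \<Lambda>1(1)]
        continuous_on_Pair continuous_on_fst continuous_on_id continuous_on_compose2[OF continuous_funpow] continuous_on_snd)
      show "(\<lambda>z. (fst z, (\<gamma> ^^ (q - i)) (snd z))) ` (T \<times> G i) \<subseteq> T \<times> K"
        using funpow_cancel(1) K' that by (auto simp: G_def)
    qed (use GS in auto)
    then show ?thesis
      by (rule continuous_on_eq) (use onG that in auto)
  qed
  have "continuous_on (T \<times> A) \<Lambda>'"
    by (rule continuous_on_eq[OF A'(3)]) (use onA in auto)
  moreover have "continuous_on (\<Union>i<q. T \<times> G i) \<Lambda>'"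
    by (intro continuous_on_closed_Union closed_Times T closedG contG) auto
  ultimately have "continuous_on (T \<times> A \<union> (\<Union>i<q. T \<times> G i)) \<Lambda>'"
    by (intro continuous_on_closed_Un closed_Times T A'(1) closed_UN) (auto intro: closed_Times T closedG)
  moreover have "T \<times> A \<union> (\<Union>i<q. T \<times> G i) = T \<times> A2"
    by (auto simp: A2_def)
  ultimately have "continuous_on (T \<times> A2) \<Lambda>'" by simp
  moreover have "closed A2" "A2 \<subseteq> S"
    unfolding A2_def using A'(1,2) GS by (auto intro!: closed_Un closed_UN closedG)
  ultimately have "section_on A2 \<Lambda>'"
    unfolding section_on_def using step by auto
  moreover have "K \<subseteq> A2"
    using q_pos by (auto simp: A2_def G_def intro!: bexI[of _ 0])
  ultimately show thesis using that[of A2 \<Lambda>'] by (auto simp: A2_def)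
qed

text \<open>Induction over a finite cover by small sets, starting from the empty section.\<close>

lemma equivariant_section:
  obtains \<Lambda> where "continuous_on (T \<times> S) \<Lambda>" "\<And>y. y \<in> S \<Longrightarrow> Adm y (\<lambda>t. \<Lambda> (t, y))"
    "\<And>t y. t \<in> T \<Longrightarrow> y \<in> S \<Longrightarrow> \<Lambda> (t, \<gamma> y) = \<theta> (\<Lambda> (t, y))"
proof -
  obtain \<K> where \<K>: "finite \<K>" "\<And>K. K \<in> \<K> \<Longrightarrow> small K" "\<Union>\<K> = S"
    using finite_small_cover by blast
  have "\<exists>A \<Lambda>. section_on A \<Lambda> \<and> \<Union>\<K> \<subseteq> A"
    using \<K>(1,2)
  proof (induction \<K> rule: finite_induct)
    case empty
    have "section_on {} (\<lambda>_. undefined)" by (simp add: section_on_def)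
    then show ?case by auto
  next
    case (insert K \<K>)
    then obtain A \<Lambda> where A: "section_on A \<Lambda>" "\<Union>\<K> \<subseteq> A" by auto
    obtain A' \<Lambda>' where "section_on A' \<Lambda>'" "A \<subseteq> A'" "K \<subseteq> A'"
      using section_on_extend[OF A(1), of K] insert.prems by blast
    then show ?case using A(2) by (intro exI[of _ A'] exI[of _ \<Lambda>']) auto
  qed
  then obtain A \<Lambda> where "section_on A \<Lambda>" "S \<subseteq> A" using \<K>(3) by auto
  then have "section_on S \<Lambda>" by (metis section_on_def subset_antisym)
  then show thesis
    using that unfolding section_on_def by blast
qed

end

end

section \<open>Equivariant homotopy equivalences of spheres\<close>

definition equivariant_on :: "'a set \<Rightarrow> ('a \<Rightarrow> 'a) \<Rightarrow> ('a \<Rightarrow> 'a) \<Rightarrow> ('a \<Rightarrow> 'a) \<Rightarrow> bool" where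
  "equivariant_on S a b f \<longleftrightarrow> (\<forall>x\<in>S. f x \<in> S \<and> f (a x) = b (f x))"

definition equivariantly_equivalent :: "'a::topological_space set \<Rightarrow> ('a \<Rightarrow> 'a) \<Rightarrow> ('a \<Rightarrow> 'a) \<Rightarrow> bool" where
  "equivariantly_equivalent S a b \<longleftrightarrow> (\<exists>f g. continuous_on S f \<and> equivariant_on S a b f \<and>
     continuous_on S g \<and> equivariant_on S b a g \<and>
     homotopic_with_canon (equivariant_on S a a) S S (g \<circ> f) id \<and>
     homotopic_with_canon (equivariant_on S b b) S S (f \<circ> g) id)"

definition rot :: "complex \<Rightarrow> complex \<Rightarrow> complex \<times> complex \<Rightarrow> complex \<times> complex" where
  "rot u v x = (u * fst x, v * snd x)"

lemma norm_rot [simp]: "cmod u = 1 \<Longrightarrow> cmod v = 1 \<Longrightarrow> norm (rot u v x) = norm x"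
  by (simp add: rot_def norm_prod_def norm_mult)

lemma funpow_rot: "(rot u v ^^ i) x = rot (u ^ i) (v ^ i) x"
  by (induction i arbitrary: x) (simp_all add: rot_def)

lemma continuous_on_rot [continuous_intros]:
  "continuous_on S f \<Longrightarrow> continuous_on S (\<lambda>x. rot u v (f x))"
  unfolding rot_def by (intro continuous_intros)

text \<open>Both numbers have exact order \<open>q\<close>, since on the sphere either coordinate
  can vanish and the other must then detect freeness.\<close>

definition free_roots :: "nat \<Rightarrow> complex \<Rightarrow> complex \<Rightarrow> bool" where
  "free_roots q u v \<longleftrightarrow> q > 0 \<and> u ^ q = 1 \<and> v ^ q = 1 \<and> (\<forall>i. 0 < i \<and> i < q \<longrightarrow> u ^ i \<noteq> 1 \<and> v ^ i \<noteq> 1)"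

lemma cmod_free_roots: "free_roots q u v \<Longrightarrow> cmod u = 1 \<and> cmod v = 1"
  unfolding free_roots_def by (metis less_irrefl power_eq_1_iff)

lemma free_cyclic_action_rot:
  assumes "free_roots q u v"
  shows "free_cyclic_action S3 (rot u v) q"
proof
  show "q > 0" using assms by (simp add: free_roots_def)
  show "continuous_on S3 (rot u v)"
    using continuous_on_rot[OF continuous_on_id] by simp
  fix x assume x: "x \<in> S3"
  show "rot u v x \<in> S3" using x cmod_free_roots[OF assms] by simp
  show "(rot u v ^^ q) x = x" using assms by (simp add: funpow_rot free_roots_def rot_def)
  fix i :: nat assume i: "0 < i" "i < q"
  have "x \<noteq> 0" using x by auto
  then have "fst x \<noteq> 0 \<or> snd x \<noteq> 0" by (simp add: prod_eq_iff)
  then show "(rot u v ^^ i) x \<noteq> x"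
    using assms i by (auto simp: funpow_rot rot_def prod_eq_iff free_roots_def)
qed simp

text \<open>A lift of \<open>y\<close> is a point \<open>x\<close> with a path \<open>H\<close> from \<open>y\<close> to \<open>f x\<close>. If \<open>F\<close> is a
  homotopy from the identity to \<open>f\<close>, then \<open>H \<mapsto> H F(x)\<^sup>-\<^sup>1 x\<close> is a bijection onto the paths from
  \<open>y\<close> to \<open>x\<close>, so that lifts extend by the homotopy extension property.\<close>

lemma equivariant_right_inverse:
  assumes uv: "free_roots q u v" and uv': "free_roots q u' v'"
    and f: "continuous_on S3 f" "equivariant_on S3 (rot u' v') (rot u v) f" "(\<lambda>x. x) \<sim>\<^sub>S f"
  obtains g where "continuous_on S3 g" "equivariant_on S3 (rot u v) (rot u' v') g" "(\<lambda>x. x) \<sim>\<^sub>S g"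
    "homotopic_with_canon (equivariant_on S3 (rot u v) (rot u v)) S3 S3 id (f \<circ> g)"
proof -
  interpret free_cyclic_action S3 "rot u v" q
    by (rule free_cyclic_action_rot[OF uv])
  let ?I = "{0..1::real}"
  have nf: "norm (f x) = 1" and ef: "f (rot u' v' x) = rot u v (f x)" if "norm x = 1" for x
    using f(2) that by (auto simp: equivariant_on_def)
  have cm: "cmod u = 1" "cmod v = 1" "cmod u' = 1" "cmod v' = 1"
    using cmod_free_roots uv uv' by auto
  obtain F :: "real \<times> _ \<Rightarrow> _" where F: "continuous_on (?I \<times> S3) F"
      "\<And>t x. t \<in> ?I \<Longrightarrow> x \<in> S3 \<Longrightarrow> F (t, x) \<in> S3" "\<And>x. F (0, x) = x" "\<And>x. F (1, x) = f x"
    using f(3) by (elim homotopic_with_canonE) blast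
  have nF: "norm (F (t, x)) = 1" if "t \<in> ?I" "norm x = 1" for t x
    using F(2)[of t x] that by simp
  \<comment> \<open>A section takes values in pairs of a lift and a point on its path; the generator
    acts on each component by its own rotation.\<close>
  define \<theta> where "\<theta> z = (rot u' v' (fst z), rot u v (snd z))" for z
  have \<theta>_pow: "(\<theta> ^^ i) z = ((rot u' v' ^^ i) (fst z), (rot u v ^^ i) (snd z))" for i z
    by (induction i) (simp_all add: \<theta>_def)
  \<comment> \<open>The lift is stored as a component constant in time, so that lift and path
    together form one function of \<open>(t, y)\<close>.\<close>
  define Adm where "Adm y p \<longleftrightarrow> (\<forall>t\<in>?I. fst (p t) = fst (p 1) \<and> norm (snd (p t)) = 1) \<and>
      norm (fst (p 1)) = 1 \<and> snd (p 0) = y \<and> snd (p 1) = f (fst (p 1))"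
    for y and p :: "real \<Rightarrow> (complex \<times> complex) \<times> (complex \<times> complex)"
  obtain \<Lambda> where \<Lambda>: "continuous_on (?I \<times> S3) \<Lambda>" "\<And>y. y \<in> S3 \<Longrightarrow> Adm y (\<lambda>t. \<Lambda> (t, y))"
      "\<And>t y. t \<in> ?I \<Longrightarrow> y \<in> S3 \<Longrightarrow> \<Lambda> (t, rot u v y) = \<theta> (\<Lambda> (t, y))"
  proof (rule equivariant_section[where T = ?I and \<theta> = \<theta> and Adm = Adm])
    show "continuous_on UNIV \<theta>"
      unfolding \<theta>_def by (intro continuous_intros)
    show "(\<theta> ^^ q) z = z" for z
      using uv uv' by (simp add: \<theta>_pow funpow_rot free_roots_def) (simp add: rot_def)
    show "Adm (rot u v y) (\<lambda>t. \<theta> (p t))" if "Adm y p" for y p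
    proof -
      define x where "x = fst (p 1)"
      have "\<And>t. t \<in> ?I \<Longrightarrow> fst (p t) = x \<and> norm (snd (p t)) = 1" "norm x = 1" "snd (p 0) = y" "snd (p 1) = f x"
        using that unfolding Adm_def x_def by blast+
      then show ?thesis
        unfolding Adm_def by (simp add: \<theta>_def ef cm)
    qed
    fix K L :: "(complex \<times> complex) set" and \<Lambda>
    assume K: "closed K" "K \<subseteq> S3" and L: "closed L" "L \<subseteq> K"
      and \<Lambda>: "continuous_on (?I \<times> L) \<Lambda>" "\<And>y. y \<in> L \<Longrightarrow> Adm y (\<lambda>t. \<Lambda> (t, y))"
    have K1: "norm y = 1" if "y \<in> K" for y using K that by auto
    have \<Lambda>n: "norm (fst (\<Lambda> (t, y))) = 1" "norm (snd (\<Lambda> (t, y))) = 1" "fst (\<Lambda> (t, y)) = fst (\<Lambda> (1, y))"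
        "snd (\<Lambda> (0, y)) = y" "snd (\<Lambda> (1, y)) = f (fst (\<Lambda> (1, y)))" if "t \<in> ?I" "y \<in> L" for t y
      using \<Lambda>(2)[OF that(2)] that(1) unfolding Adm_def by metis+
    \<comment> \<open>With lift \<open>x\<close> this is a path from \<open>y\<close> to
      \<open>x\<close>: at time 0 the factors \<open>x\<close> cancel, and at time 1 path and
      \<open>F\<close> both equal \<open>f x\<close>.\<close>
    define h where "h = (\<lambda>z. qmul (qmul (snd (\<Lambda> z)) (qinv (F (fst z, fst (\<Lambda> z))))) (fst (\<Lambda> z)))"
    have h1: "continuous_on (?I \<times> L) h"
      unfolding h_def
      by (intro continuous_on_qmul continuous_on_qinv continuous_on_compose2[OF F(1)] continuous_on_Pair
          continuous_on_fst continuous_on_snd \<Lambda>(1) continuous_on_id) (use \<Lambda>n(1,2) in auto)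
    have h2: "h (t, y) \<in> S3" if "t \<in> ?I" "y \<in> L" for t y
      using \<Lambda>n[OF that] nF that by (simp add: h_def)
    have h3: "h (0, y) = y" if "y \<in> L" for y
      using \<Lambda>n[of 0 y] that by (simp add: h_def F(3) qmul_assoc)
    have cl: "closedin (top_of_set K) L"
      using L by (simp add: closed_subset)
    have KS: "y \<in> S3" if "y \<in> K" for y
      using that K by blast
    \<comment> \<open>The homotopy extension property is applied to the inclusion of
      \<open>K\<close>; the end point of \<open>k\<close> becomes the new lift.\<close>
    obtain k where k: "continuous_on (?I \<times> K) k" "\<And>t y. t \<in> ?I \<Longrightarrow> y \<in> K \<Longrightarrow> k (t, y) \<in> S3"
        "\<And>y. y \<in> K \<Longrightarrow> k (0, y) = y" "\<And>t y. t \<in> ?I \<Longrightarrow> y \<in> L \<Longrightarrow> k (t, y) = h (t, y)"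
      using homotopy_extension[OF ANR_sphere cl continuous_on_id KS h1 h2 h3] by blast
    have nk: "norm (k (t, y)) = 1" if "t \<in> ?I" "y \<in> K" for t y
      using k(2)[OF that] by simp
    have kL: "k (1, y) = fst (\<Lambda> (1, y))" if "y \<in> L" for y
      using k(4)[of 1 y] \<Lambda>n[of 1 y] that nf by (simp add: h_def F(4))
    \<comment> \<open>The inverse of the transformation that produced \<open>h\<close>, so the old
      section is recovered on \<open>L\<close>.\<close>
    define \<Lambda>' where "\<Lambda>' = (\<lambda>z. (k (1, snd z), qmul (qmul (k z) (qinv (k (1, snd z)))) (F (fst z, k (1, snd z)))))"
    have "continuous_on (?I \<times> K) \<Lambda>'"
      unfolding \<Lambda>'_def
      by (intro continuous_on_qmul continuous_on_qinv continuous_on_compose2[OF F(1)] continuous_on_Pair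
          continuous_on_fst continuous_on_snd continuous_on_id continuous_on_compose2[OF k(1)] k(1) continuous_on_const)
        (use k(2) in auto)
    moreover have "Adm y (\<lambda>t. \<Lambda>' (t, y))" if "y \<in> K" for y
      using that nk k(3) nF[OF _ nk[OF _ that]] by (simp add: Adm_def \<Lambda>'_def F(3,4) qmul_assoc)
    moreover have "\<Lambda>' (t, y) = \<Lambda> (t, y)" if "t \<in> ?I" "y \<in> L" for t y
      using \<Lambda>n[OF that] nF[of t "fst (\<Lambda> (t, y))"] that k(4)[OF that] kL[OF that(2)]
      by (simp add: \<Lambda>'_def h_def qmul_assoc prod_eq_iff[of _ "\<Lambda> (t, y)"])
    ultimately show "\<exists>\<Lambda>'. continuous_on (?I \<times> K) \<Lambda>' \<and> (\<forall>y\<in>K. Adm y (\<lambda>t. \<Lambda>' (t, y))) \<and>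
        (\<forall>t\<in>?I. \<forall>y\<in>L. \<Lambda>' (t, y) = \<Lambda> (t, y))"
      by blast
  qed (simp, blast)
  have \<Lambda>': "continuous_on (?I \<times> S3) \<Lambda>" "\<And>y. norm y = 1 \<Longrightarrow> Adm y (\<lambda>t. \<Lambda> (t, y))"
      "\<And>t y. t \<in> ?I \<Longrightarrow> norm y = 1 \<Longrightarrow> \<Lambda> (t, rot u v y) = \<theta> (\<Lambda> (t, y))"
    using \<Lambda> by simp_all
  have \<Lambda>n: "norm (fst (\<Lambda> (t, y))) = 1" "norm (snd (\<Lambda> (t, y))) = 1" "fst (\<Lambda> (t, y)) = fst (\<Lambda> (1, y))"
        "snd (\<Lambda> (0, y)) = y" "snd (\<Lambda> (1, y)) = f (fst (\<Lambda> (1, y)))" if "t \<in> ?I" "norm y = 1" for t y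
      using \<Lambda>'(2)[OF that(2)] that(1) unfolding Adm_def by metis+
  \<comment> \<open>The lifts form \<open>g\<close>, and the paths form an equivariant homotopy from
    the identity to \<open>f \<circ> g\<close>.\<close>
  define g where "g y = fst (\<Lambda> (1, y))" for y
  have cg: "continuous_on S3 g"
    unfolding g_def
    by (intro continuous_on_fst continuous_on_compose2[OF \<Lambda>'(1)] continuous_on_Pair continuous_on_const continuous_on_id) auto
  have eg: "equivariant_on S3 (rot u v) (rot u' v') g"
    using \<Lambda>n[of 1] \<Lambda>'(3)[of 1] by (simp add: equivariant_on_def g_def \<theta>_def)
  have "homotopic_with_canon (equivariant_on S3 (rot u v) (rot u v)) S3 S3
      (\<lambda>x. snd (\<Lambda> (0, x))) (\<lambda>x. snd (\<Lambda> (1, x)))"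
  proof (rule homotopic_with_canonI[where h = "\<lambda>z. snd (\<Lambda> z)"])
    show "equivariant_on S3 (rot u v) (rot u v) (\<lambda>x. snd (\<Lambda> (t, x)))" if "t \<in> ?I" for t
      using \<Lambda>n[of t] \<Lambda>'(3)[of t] that by (simp add: equivariant_on_def \<theta>_def)
  qed (use \<Lambda>n(1,2) \<Lambda>'(1) in \<open>auto intro: continuous_on_snd\<close>)
  then have hg: "homotopic_with_canon (equivariant_on S3 (rot u v) (rot u v)) S3 S3 id (f \<circ> g)"
    by (rule homotopic_with_eq) (use \<Lambda>n[of 0] \<Lambda>n[of 1] cm in \<open>auto simp: g_def equivariant_on_def\<close>)
  have ng: "norm (g y) = 1" if "norm y = 1" for y
    using \<Lambda>n(1)[of 1 y] that by (simp add: g_def)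
  \<comment> \<open>The same cancellation turns the paths into a homotopy from the identity to
    \<open>g\<close>, so that the construction can be applied again to \<open>g\<close>.\<close>
  have "homotopic_with_canon (\<lambda>_. True) S3 S3
     (\<lambda>y. qmul (qmul (snd (\<Lambda> (0, y))) (qinv (F (0, g y)))) (g y)) (\<lambda>y. qmul (qmul (snd (\<Lambda> (1, y))) (qinv (F (1, g y)))) (g y))"
  proof (rule homotopic_with_canonI[where h = "\<lambda>z. qmul (qmul (snd (\<Lambda> z)) (qinv (F (fst z, g (snd z))))) (g (snd z))"])
    show "continuous_on (?I \<times> S3) (\<lambda>z. qmul (qmul (snd (\<Lambda> z)) (qinv (F (fst z, g (snd z))))) (g (snd z)))"
      by (intro continuous_on_qmul continuous_on_qinv continuous_on_compose2[OF F(1)] continuous_on_Pair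
          continuous_on_fst continuous_on_snd continuous_on_id continuous_on_compose2[OF cg] \<Lambda>'(1))
        (use ng in auto)
  qed (use ng \<Lambda>n(2) nF in simp_all)
  then have "(\<lambda>x. x) \<sim>\<^sub>S g"
    by (rule homotopic_with_eq) (use \<Lambda>n[of 0] \<Lambda>n[of 1] nf in \<open>simp_all add: g_def F qmul_assoc\<close>)
  with cg eg show thesis using hg by (rule that)
qed

text \<open>With \<open>g\<close> a right inverse of \<open>f\<close> and \<open>h\<close> a right
  inverse of \<open>g\<close>, up to equivariant homotopy, \<open>g f\<close> is homotopic to
  \<open>g f g h\<close>, hence to \<open>g h\<close> and to the identity.\<close>

lemma equivariant_homotopy_equivalence:
  assumes uv: "free_roots q u v" and uv': "free_roots q u' v'"
    and f: "continuous_on S3 f" "equivariant_on S3 (rot u v) (rot u' v') f" "(\<lambda>x. x) \<sim>\<^sub>S f"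
  shows "equivariantly_equivalent S3 (rot u v) (rot u' v')"
proof -
  let ?a = "rot u v" and ?b = "rot u' v'"
  obtain g where g: "continuous_on S3 g" "equivariant_on S3 ?b ?a g" "(\<lambda>x. x) \<sim>\<^sub>S g"
    "homotopic_with_canon (equivariant_on S3 ?b ?b) S3 S3 id (f \<circ> g)"
    using equivariant_right_inverse[OF uv' uv f] .
  obtain h where h: "continuous_on S3 h" "equivariant_on S3 ?a ?b h"
    "homotopic_with_canon (equivariant_on S3 ?a ?a) S3 S3 id (g \<circ> h)"
    using equivariant_right_inverse[OF uv uv' g(1-3)] .
  have sub: "f \<in> S3 \<rightarrow> S3" "g \<in> S3 \<rightarrow> S3" "h \<in> S3 \<rightarrow> S3"
    using f g h by (auto simp: equivariant_on_def)
  have eq_comp: "equivariant_on S3 \<alpha> \<gamma> (j \<circ> i)" if "equivariant_on S3 \<alpha> \<beta> i" "equivariant_on S3 \<beta> \<gamma> j"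
    for \<alpha> \<beta> \<gamma> i j using that by (simp add: equivariant_on_def)
  have "homotopic_with_canon (equivariant_on S3 ?a ?b) S3 S3 (id \<circ> h) ((f \<circ> g) \<circ> h)"
    by (rule homotopic_with_compose_continuous_map_right[OF g(4)]) (use h sub eq_comp in auto)
  then have "homotopic_with_canon (equivariant_on S3 ?a ?a) S3 S3 (g \<circ> (id \<circ> h)) (g \<circ> ((f \<circ> g) \<circ> h))"
    by (rule homotopic_with_compose_continuous_map_left) (use g sub eq_comp in auto)
  then have 1: "homotopic_with_canon (equivariant_on S3 ?a ?a) S3 S3 (g \<circ> h) ((g \<circ> f) \<circ> (g \<circ> h))"
    by (simp add: o_assoc)
  have 2: "homotopic_with_canon (equivariant_on S3 ?a ?a) S3 S3 ((g \<circ> f) \<circ> id) ((g \<circ> f) \<circ> (g \<circ> h))"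
  proof (rule homotopic_with_compose_continuous_map_left[OF h(3)])
    show "continuous_map (top_of_set S3) (top_of_set S3) (g \<circ> f)"
      using f(1) g(1) sub by (intro continuous_map_compose[where X' = "top_of_set S3"]) auto
    show "equivariant_on S3 ?a ?a ((g \<circ> f) \<circ> j)" if "equivariant_on S3 ?a ?a j" for j
      using eq_comp[OF that eq_comp[OF f(2) g(2)]] .
  qed
  have "homotopic_with_canon (equivariant_on S3 ?a ?a) S3 S3 (g \<circ> f) id"
    using homotopic_with_trans[OF 2[unfolded comp_id] homotopic_with_trans[OF homotopic_with_symD[OF 1] homotopic_with_symD[OF h(3)]]] .
  then show ?thesis
    unfolding equivariantly_equivalent_def using f g homotopic_with_symD by blast
qed

section \<open>Roots of unity\<close>

definition zeta :: "nat \<Rightarrow> int \<Rightarrow> complex" where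
  "zeta q k = cis (2 * pi * of_int k / of_nat q)"

lemma cmod_zeta [simp]: "cmod (zeta q k) = 1"
  by (simp add: zeta_def)

lemma zeta_add: "zeta q (j + k) = zeta q j * zeta q k"
  by (simp add: zeta_def cis_mult add_divide_distrib ring_distribs)

lemma zeta_minus: "zeta q (- k) = cnj (zeta q k)"
  by (simp add: zeta_def cis_cnj)

lemma zeta_power: "zeta q k ^ n = zeta q (int n * k)"
proof (induction n)
  case (Suc n)
  then show ?case
    using zeta_add[of q k "int n * k"] by (simp add: ring_distribs)
qed (simp add: zeta_def)

lemma zeta_eq_1_iff:
  assumes "q > 0"
  shows "zeta q k = 1 \<longleftrightarrow> int q dvd k"
proof -
  have "zeta q k = 1 \<longleftrightarrow> cos (2 * pi * of_int k / of_nat q) = 1"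
    by (auto simp: zeta_def complex_eq_iff) (metis cos_one_sin_zero)
  also have "\<dots> \<longleftrightarrow> (\<exists>n::int. 2 * pi * of_int k / of_nat q = of_int n * 2 * pi)"
    by (rule cos_one_2pi_int)
  also have "\<dots> \<longleftrightarrow> (\<exists>n::int. (of_int k :: real) = of_int (int q * n))"
    using assms by (auto simp: field_simps)
  also have "\<dots> \<longleftrightarrow> int q dvd k"
    unfolding of_int_eq_iff by (auto simp: dvd_def)
  finally show ?thesis .
qed

lemma zeta_cong:
  assumes "q > 0" "[j = k] (mod int q)"
  shows "zeta q j = zeta q k"
proof -
  have "int q dvd j - k"
    using assms(2) by (simp add: cong_iff_dvd_diff)
  then have "zeta q (j - k) = 1"
    using assms(1) by (simp add: zeta_eq_1_iff)
  then show ?thesis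
    using zeta_add[of q "j - k" k] by simp
qed

lemma free_roots_zeta:
  assumes "q > 0" "coprime j (int q)" "coprime k (int q)"
  shows "free_roots q (zeta q j) (zeta q k)"
proof -
  have "zeta q s ^ i \<noteq> 1" if "0 < i" "i < q" "coprime s (int q)" for s i
  proof
    assume "zeta q s ^ i = 1"
    then have "int q dvd int i * s"
      using assms(1) by (simp add: zeta_power zeta_eq_1_iff)
    then have "int q dvd int i"
      using that(3) by (simp add: coprime_commute coprime_dvd_mult_left_iff)
    then show False
      using that by (simp add: nat_dvd_not_less)
  qed
  then show ?thesis
    using assms by (simp add: free_roots_def zeta_power zeta_eq_1_iff)
qed

section \<open>Inverses modulo \<open>q\<close> and the choice of exponents\<close>

lemma cong_inverse:
  fixes a :: int
  assumes "coprime a (int q)" "q > 0"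
  obtains b :: nat where "b > 0" "[a * int b = 1] (mod int q)"
proof -
  obtain x where x: "[a * x = 1] (mod int q)"
    using cong_solve_coprime_int[OF assms(1)] by blast
  \<comment> \<open>Adding \<open>q\<close> keeps \<open>b\<close> positive even if the residue is
    0.\<close>
  define b where "b = nat (x mod int q) + q"
  have "int b = x mod int q + int q"
    using assms(2) by (simp add: b_def)
  then have "[int b = x] (mod int q)"
    by (simp add: cong_def)
  then have "[a * int b = a * x] (mod int q)"
    by (rule cong_scalar_left)
  with x have "[a * int b = 1] (mod int q)"
    by (rule cong_trans[rotated])
  moreover have "b > 0" using assms(2) by (simp add: b_def)
  ultimately show thesis using that by blast
qed

text \<open>Choosing \<open>c \<equiv> 1 (mod n)\<close> makes \<open>n\<close> a unit modulo \<open>q * c\<close>; its inverse \<open>m\<close> is then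
  automatically correct modulo \<open>q\<close>.\<close>

lemma join_exponents:
  fixes s\<^sub>1 s\<^sub>2 a\<^sub>1 a\<^sub>2 :: int
  assumes q: "q > 0" and cop: "coprime s\<^sub>2 (int q)" "coprime a\<^sub>2 (int q)"
    and prod: "[a\<^sub>1 * a\<^sub>2 = s\<^sub>1 * s\<^sub>2] (mod int q)"
  obtains m n c k :: nat where "m * n = 1 + q * c * k"
    "[int m * s\<^sub>1 = a\<^sub>1] (mod int q)" "[int n * s\<^sub>2 = a\<^sub>2] (mod int q)" "[int c * s\<^sub>2 = a\<^sub>2 - a\<^sub>1] (mod int q)"
proof -
  obtain t where t: "[s\<^sub>2 * int t = 1] (mod int q)"
    using cong_inverse[OF cop(1) q] by blast
  define n where "n = nat ((a\<^sub>2 * int t) mod int q) + q"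
  have n0: "n > 0" using q by (simp add: n_def)
  have "int n = (a\<^sub>2 * int t) mod int q + int q"
    using q by (simp add: n_def)
  then have n: "[int n = a\<^sub>2 * int t] (mod int q)"
    by (simp add: cong_def)
  have ns: "[int n * s\<^sub>2 = a\<^sub>2] (mod int q)"
  proof -
    have "[int n * s\<^sub>2 = a\<^sub>2 * int t * s\<^sub>2] (mod int q)"
      by (rule cong_scalar_right[OF n])
    moreover have "[a\<^sub>2 * (s\<^sub>2 * int t) = a\<^sub>2 * 1] (mod int q)"
      by (rule cong_scalar_left[OF t])
    ultimately show ?thesis
      by (simp add: mult_ac) (metis cong_trans)
  qed
  have "coprime (int n * s\<^sub>2) (int q)"
    using ns cop(2) cong_imp_coprime cong_sym by blast
  then have nq: "coprime (int n) (int q)"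
    by simp
  obtain n' where n': "[int n * int n' = 1] (mod int q)"
    using cong_inverse[OF nq q] by blast
  \<comment> \<open>The required residue of \<open>c\<close> is \<open>d\<close>. Since
    \<open>y\<close> solves \<open>n * y \<equiv> d - 1\<close> modulo \<open>q\<close>, the number
    \<open>1 + n * y\<close> is \<open>d\<close> modulo \<open>q\<close> and 1 modulo
    \<open>n\<close>.\<close>
  define d where "d = (a\<^sub>2 - a\<^sub>1) * int t"
  define y where "y = nat ((int n' * (d - 1)) mod int q)"
  have y: "[int y = int n' * (d - 1)] (mod int q)"
    using q by (simp add: y_def cong_def)
  define c where "c = 1 + n * y"
  have "[int n * int y = int n * (int n' * (d - 1))] (mod int q)"
    by (rule cong_scalar_left[OF y])
  moreover have "[int n * int n' * (d - 1) = 1 * (d - 1)] (mod int q)"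
    by (rule cong_scalar_right[OF n'])
  ultimately have "[int n * int y = d - 1] (mod int q)"
    by (simp add: mult_ac) (metis cong_trans)
  then have "[1 + int n * int y = 1 + (d - 1)] (mod int q)"
    by (intro cong_add) simp_all
  then have c: "[int c = d] (mod int q)"
    by (simp add: c_def)
  have cs: "[int c * s\<^sub>2 = a\<^sub>2 - a\<^sub>1] (mod int q)"
  proof -
    have "[int c * s\<^sub>2 = d * s\<^sub>2] (mod int q)"
      by (rule cong_scalar_right[OF c])
    moreover have "[(a\<^sub>2 - a\<^sub>1) * (s\<^sub>2 * int t) = (a\<^sub>2 - a\<^sub>1) * 1] (mod int q)"
      by (rule cong_scalar_left[OF t])
    ultimately show ?thesis
      unfolding d_def mult_1_right by (metis cong_trans mult.assoc mult.commute)
  qed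
  have "coprime n c"
  proof (rule coprimeI)
    fix d assume "d dvd n" "d dvd c"
    then show "d dvd 1"
      unfolding c_def by (meson dvd_add_left_iff dvd_mult2)
  qed
  then have "coprime n (q * c)"
    using nq by simp
  then have "coprime (int n) (int (q * c))"
    using coprime_int_iff by blast
  moreover have qc: "q * c > 0" using q by (simp add: c_def)
  ultimately obtain m where m: "m > 0" "[int n * int m = 1] (mod int (q * c))"
    using cong_inverse by blast
  from m(2) have "[n * m = 1] (mod (q * c))"
    by (metis cong_int_iff of_nat_1 of_nat_mult)
  moreover have "n * m \<noteq> 0" using n0 m(1) by simp
  ultimately obtain k where k: "n * m = 1 + k * (q * c)"
    using cong_to_1'_nat[of "n * m" "q * c"] by metis
  have "[int n * int m = 1] (mod int q)"
    by (rule cong_dvd_modulus[OF m(2)]) simp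
  \<comment> \<open>Modulo \<open>q\<close>, multiplying the product condition by \<open>m\<close>
    and using \<open>n * m \<equiv> 1\<close> leaves a common unit factor \<open>s\<^sub>2\<close>
    to cancel.\<close>
  have ms: "[int m * s\<^sub>1 = a\<^sub>1] (mod int q)"
  proof -
    have 1: "[a\<^sub>1 * (int n * s\<^sub>2) = s\<^sub>1 * s\<^sub>2] (mod int q)"
      using cong_scalar_left[OF ns] prod cong_trans by blast
    have "[int m * (a\<^sub>1 * (int n * s\<^sub>2)) = int m * (s\<^sub>1 * s\<^sub>2)] (mod int q)"
      by (rule cong_scalar_left[OF 1])
    moreover have "[int n * int m * (a\<^sub>1 * s\<^sub>2) = 1 * (a\<^sub>1 * s\<^sub>2)] (mod int q)"
      by (rule cong_scalar_right) fact
    moreover have "int m * (a\<^sub>1 * (int n * s\<^sub>2)) = int n * int m * (a\<^sub>1 * s\<^sub>2)"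
      by simp
    ultimately have "[int m * (s\<^sub>1 * s\<^sub>2) = a\<^sub>1 * s\<^sub>2] (mod int q)"
      by (metis cong_sym cong_trans mult_1)
    then have "[(int m * s\<^sub>1) * s\<^sub>2 = a\<^sub>1 * s\<^sub>2] (mod int q)"
      by (simp add: mult.assoc)
    then show ?thesis
      using cop(1) by (simp add: cong_mult_rcancel)
  qed
  show thesis
    by (rule that[of m n c k]) (use k ms ns cs in \<open>simp_all add: mult_ac\<close>)
qed

text \<open>In quaternions \<open>rot u v x\<close> is \<open>p x c\<close> for unit complex numbers
  with \<open>p c = u\<close> and \<open>p (cnj c) = v\<close>, and
  \<open>rot 1 (v * cnj u) y\<close> is the conjugate of \<open>y\<close> by \<open>c\<close>, so
  the inner factors cancel.\<close>

lemma qmul_rot: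
  assumes "cmod u = 1" "cmod v = 1"
  shows "qmul (rot u v x) (rot 1 (v * cnj u) y) = rot u v (qmul x y)"
proof -
  have "u * cnj u = 1" "v * cnj v = 1"
    using assms by (simp_all flip: complex_norm_square)
  then have *: "u * (cnj u * z) = z" "v * (cnj v * z) = z" for z
    by (metis mult.assoc mult_1)+
  show ?thesis
    by (simp add: qmul_def rot_def algebra_simps *)
qed

text \<open>\<open>rot 1 w\<close> is a conjugation, hence multiplicative.\<close>

lemma qpow_rot:
  assumes "cmod w = 1"
  shows "qpow (rot 1 w x) k = rot 1 w (qpow x k)"
proof (induction k)
  case (Suc k)
  then show ?case
    using qmul_rot[of 1 w "qpow x k" x] assms by simp
qed (simp add: rot_def)

lemma qinv_rot: "qinv (rot 1 w x) = rot 1 w (qinv x)"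
  by (simp add: qinv_def rot_def)

lemma join_power_rot:
  assumes "cmod u = 1" "cmod v = 1"
  shows "join_power m n (rot u v x) = rot (u ^ m) (v ^ n) (join_power m n x)"
  using assms by (simp add: join_power_def rot_def circle_power_mult)

lemma equivariantly_equivalent_S3:
  fixes s\<^sub>1 s\<^sub>2 a\<^sub>1 a\<^sub>2 :: int
  assumes q: "q > 0" and cop: "coprime s\<^sub>1 (int q)" "coprime s\<^sub>2 (int q)" "coprime a\<^sub>1 (int q)" "coprime a\<^sub>2 (int q)"
    and prod: "[a\<^sub>1 * a\<^sub>2 = s\<^sub>1 * s\<^sub>2] (mod int q)"
  shows "equivariantly_equivalent S3 (rot (zeta q s\<^sub>1) (zeta q s\<^sub>2)) (rot (zeta q a\<^sub>1) (zeta q a\<^sub>2))"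
proof -
  obtain m n c k where mnck: "m * n = 1 + q * c * k"
    "[int m * s\<^sub>1 = a\<^sub>1] (mod int q)" "[int n * s\<^sub>2 = a\<^sub>2] (mod int q)" "[int c * s\<^sub>2 = a\<^sub>2 - a\<^sub>1] (mod int q)"
    using join_exponents[OF q cop(2,4) prod] .
  \<comment> \<open>The exponent \<open>q\<close> makes the first coordinate of the correction
    invariant, and \<open>c\<close> gives its second coordinate the weight
    \<open>a\<^sub>2 - a\<^sub>1\<close>, as \<open>qmul_rot\<close> demands.\<close>
  define f where "f x = qmul (join_power m n x) (qpow (qinv (join_power q c x)) k)" for x
  have "zeta q s\<^sub>1 ^ q = 1"
    using q by (simp add: zeta_power zeta_eq_1_iff)
  moreover have "zeta q s\<^sub>2 ^ c = zeta q a\<^sub>2 * cnj (zeta q a\<^sub>1)"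
    using zeta_cong[OF q mnck(4)] zeta_add[of q a\<^sub>2 "- a\<^sub>1"] by (simp add: zeta_power zeta_minus)
  moreover have "zeta q s\<^sub>1 ^ m = zeta q a\<^sub>1" "zeta q s\<^sub>2 ^ n = zeta q a\<^sub>2"
    using zeta_cong[OF q mnck(2)] zeta_cong[OF q mnck(3)] by (simp_all add: zeta_power)
  ultimately have eq: "f (rot (zeta q s\<^sub>1) (zeta q s\<^sub>2) x) = rot (zeta q a\<^sub>1) (zeta q a\<^sub>2) (f x)" for x
    by (simp add: f_def join_power_rot qinv_rot qpow_rot norm_mult qmul_rot)
  show ?thesis
  proof (rule equivariant_homotopy_equivalence[where f = f and q = q])
    show "continuous_on S3 f"
      unfolding f_def by (intro continuous_intros)
    show "equivariant_on S3 (rot (zeta q s\<^sub>1) (zeta q s\<^sub>2)) (rot (zeta q a\<^sub>1) (zeta q a\<^sub>2)) f"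
      unfolding equivariant_on_def using eq by (simp add: f_def)
    have "f \<sim>\<^sub>S (\<lambda>x. qmul (qpow x (m * n)) (qpow (qinv (qpow x (q * c))) k))"
      unfolding f_def by (intro homotopic_qmul homotopic_qpow homotopic_qinv join_power_homotopic)
    \<comment> \<open>All factors are now powers of the same \<open>x\<close>, and
      \<open>m * n = 1 + q * c * k\<close> leaves exactly \<open>x\<close>.\<close>
    then have "f \<sim>\<^sub>S (\<lambda>x. x)"
    proof (rule homotopic_with_eq)
      fix x assume "x \<in> topspace (top_of_set S3)"
      then have "norm (qpow x (q * c)) = 1" by simp
      then show "x = qmul (qpow x (m * n)) (qpow (qinv (qpow x (q * c))) k)"
        unfolding mnck(1) qpow_add qpow_mult[of x "q * c" k] by (simp add: qmul_assoc qpow_qinv)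
    qed simp_all
    then show "(\<lambda>x. x) \<sim>\<^sub>S f"
      by (rule homotopic_with_symD)
  qed (use free_roots_zeta q cop in auto)
qed

section \<open>Joining with the identity of a circle\<close>

abbreviation S5 :: "((complex \<times> complex) \<times> complex) set" where
  "S5 \<equiv> sphere 0 1"

definition rot3 :: "complex \<Rightarrow> complex \<Rightarrow> complex \<Rightarrow> (complex \<times> complex) \<times> complex \<Rightarrow> (complex \<times> complex) \<times> complex" where
  "rot3 u v w x = (rot u v (fst x), w * snd x)"

text \<open>The radial extension of a map of the unit sphere; the factor \<open>norm x\<close> sends
  0 to 0 whatever \<open>f\<close> is there.\<close>

definition cone_ext :: "('a::real_normed_vector \<Rightarrow> 'a) \<Rightarrow> 'a \<Rightarrow> 'a" where
  "cone_ext f x = norm x *\<^sub>R f (x /\<^sub>R norm x)"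

lemma norm_cone_ext:
  assumes "\<And>x. norm x = 1 \<Longrightarrow> norm (f x) = 1"
  shows "norm (cone_ext f x) = norm x"
  using assms[of "x /\<^sub>R norm x"] by (cases "x = 0") (simp_all add: cone_ext_def)

lemma cone_ext_compose:
  assumes "\<And>x. norm x = 1 \<Longrightarrow> norm (f x) = 1"
  shows "cone_ext g (cone_ext f x) = cone_ext (g \<circ> f) x"
proof (cases "x = 0")
  case False
  then have "cone_ext f x /\<^sub>R norm x = f (x /\<^sub>R norm x)"
    by (simp add: cone_ext_def)
  then show ?thesis
    by (simp add: cone_ext_def[of g] cone_ext_def[of "g \<circ> f"] norm_cone_ext[OF assms])
qed (simp add: cone_ext_def)

lemma cone_ext_id [simp]: "cone_ext id x = x"
  by (cases "x = 0") (simp_all add: cone_ext_def)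

lemma cone_ext_rot:
  assumes "equivariant_on S3 (rot u v) (rot u' v') f" "cmod u = 1" "cmod v = 1"
  shows "cone_ext f (rot u v x) = rot u' v' (cone_ext f x)"
proof (cases "x = 0")
  case False
  have scale: "rot p q (r *\<^sub>R y) = r *\<^sub>R rot p q y" for p q r y
    by (simp add: rot_def)
  have "x /\<^sub>R norm x \<in> S3" using False by simp
  then show ?thesis
    using assms by (simp add: cone_ext_def equivariant_on_def flip: scale)
qed (simp add: cone_ext_def rot_def zero_prod_def)

text \<open>Over the origin continuity follows from preservation of the norm, for all parameters at
  once; elsewhere the map is a composition of continuous maps.\<close>

lemma continuous_cone_ext_homotopy:
  fixes h :: "'t::real_normed_vector \<times> 'a::real_normed_vector \<Rightarrow> 'a"
  assumes h: "continuous_on (T \<times> sphere 0 1) h" "\<And>t x. t \<in> T \<Longrightarrow> norm x = 1 \<Longrightarrow> norm (h (t, x)) = 1"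
  shows "continuous_on (T \<times> UNIV) (\<lambda>z. cone_ext (\<lambda>x. h (fst z, x)) (snd z))"
proof -
  let ?J = "\<lambda>z. cone_ext (\<lambda>x. h (fst z, x)) (snd z)"
  have nJ: "norm (?J z) = norm (snd z)" if "z \<in> T \<times> UNIV" for z
    using that h(2) by (intro norm_cone_ext) auto
  have "continuous (at z within T \<times> UNIV) ?J" if z: "z \<in> T \<times> UNIV" for z
  proof (cases "snd z = 0")
    case True
    have "((\<lambda>z. norm (snd z)) \<longlongrightarrow> norm (snd z)) (at z within T \<times> UNIV)"
      by (intro tendsto_intros)
    then have "((\<lambda>z. norm (snd z)) \<longlongrightarrow> 0) (at z within T \<times> UNIV)"
      using True by simp
    moreover have "\<forall>\<^sub>F z in at z within T \<times> UNIV. norm (snd z) = norm (?J z)"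
      unfolding eventually_at_filter using nJ by (auto intro!: always_eventually)
    ultimately have "((\<lambda>z. norm (?J z)) \<longlongrightarrow> 0) (at z within T \<times> UNIV)"
      by (rule Lim_transform_eventually)
    then have "(?J \<longlongrightarrow> 0) (at z within T \<times> UNIV)"
      by (rule tendsto_norm_zero_cancel)
    then show ?thesis
      using True by (simp add: continuous_within cone_ext_def)
  next
    case False
    have "continuous_on (T \<times> (- {0})) ?J"
      unfolding cone_ext_def
      by (intro continuous_on_scaleR continuous_on_norm continuous_on_snd continuous_on_id
          continuous_on_compose2[OF h(1)] continuous_on_Pair continuous_on_fst continuous_on_inverse) auto
    then have "continuous (at z within T \<times> (- {0})) ?J"
      using z False by (auto simp: continuous_on_eq_continuous_within)
    moreover have "at z within T \<times> (- {0}) = at z within T \<times> UNIV"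
      by (rule at_within_nhd[where S = "UNIV \<times> (- {0})"]) (use z False in \<open>auto intro!: open_Times open_Compl\<close>)
    ultimately show ?thesis by simp
  qed
  then show ?thesis
    by (simp add: continuous_on_eq_continuous_within)
qed

lemma continuous_cone_ext:
  fixes f :: "'a::real_normed_vector \<Rightarrow> 'a"
  assumes f: "continuous_on (sphere 0 1) f" "\<And>x. norm x = 1 \<Longrightarrow> norm (f x) = 1"
  shows "continuous_on UNIV (cone_ext f)"
proof -
  \<comment> \<open>A one-point parameter space reduces the claim to the version with
    parameters.\<close>
  have "continuous_on ({0::real} \<times> UNIV) (\<lambda>z. cone_ext (\<lambda>x. (f \<circ> snd) (fst z, x)) (snd z))"
    by (rule continuous_cone_ext_homotopy)
      (use f in \<open>auto intro!: continuous_on_compose2[OF f(1)] continuous_on_snd continuous_on_id\<close>)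
  then have "continuous_on UNIV (\<lambda>x. (\<lambda>z. cone_ext (\<lambda>x. (f \<circ> snd) (fst z, x)) (snd z)) (0::real, x))"
    by (rule continuous_on_compose2) (auto intro!: continuous_intros)
  then show ?thesis by simp
qed

text \<open>\<open>S5\<close> is viewed as the join of \<open>S3\<close> and a circle; the radial
  extension avoids an explicit join parameter.\<close>

definition join_id :: "(complex \<times> complex \<Rightarrow> complex \<times> complex) \<Rightarrow> (complex \<times> complex) \<times> complex \<Rightarrow> (complex \<times> complex) \<times> complex" where
  "join_id f x = (cone_ext f (fst x), snd x)"

lemma norm_join_id:
  assumes "\<And>x. norm x = 1 \<Longrightarrow> norm (f x) = 1"
  shows "norm (join_id f x) = norm x"
proof -
  have "norm (cone_ext f (fst x)) = norm (fst x)"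
    by (rule norm_cone_ext) (rule assms)
  then have "norm (join_id f x) = norm (fst x, snd x)"
    by (simp only: join_id_def norm_Pair)
  then show ?thesis by simp
qed

lemma equivariant_join_id:
  assumes "equivariant_on S3 (rot u v) (rot u' v') f" "cmod u = 1" "cmod v = 1"
  shows "equivariant_on S5 (rot3 u v w) (rot3 u' v' w) (join_id f)"
proof -
  have "norm (f x) = 1" if "norm x = 1" for x
    using assms that by (simp add: equivariant_on_def)
  then show ?thesis
    using cone_ext_rot[OF assms] norm_join_id[of f]
    by (simp add: equivariant_on_def join_id_def rot3_def)
qed

lemma homotopic_join_id:
  assumes "homotopic_with_canon (equivariant_on S3 (rot u v) (rot u v)) S3 S3 f g" "cmod u = 1" "cmod v = 1"
  shows "homotopic_with_canon (equivariant_on S5 (rot3 u v w) (rot3 u v w)) S5 S5 (join_id f) (join_id g)"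
proof -
  obtain h :: "real \<times> _ \<Rightarrow> _" where h: "continuous_on ({0..1} \<times> S3) h"
      "\<And>t x. t \<in> {0..1} \<Longrightarrow> x \<in> S3 \<Longrightarrow> h (t, x) \<in> S3" "\<And>x. h (0, x) = f x" "\<And>x. h (1, x) = g x"
      "\<And>t. t \<in> {0..1} \<Longrightarrow> equivariant_on S3 (rot u v) (rot u v) (\<lambda>x. h (t, x))"
    using assms(1) by (elim homotopic_with_canonE) blast
  have hn: "norm (h (t, x)) = 1" if "t \<in> {0..1}" "norm x = 1" for t x
    using h(2)[of t x] that by simp
  show ?thesis
  proof (rule homotopic_with_canonI[where h = "\<lambda>z. join_id (\<lambda>x. h (fst z, x)) (snd z)"])
    have "continuous_on ({0..1} \<times> S5) (\<lambda>z. (\<lambda>z. cone_ext (\<lambda>x. h (fst z, x)) (snd z)) (fst z, fst (snd z)))"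
      by (rule continuous_on_compose2[OF continuous_cone_ext_homotopy[OF h(1) hn]])
        (auto intro!: continuous_on_Pair continuous_on_fst continuous_on_snd continuous_on_id)
    then show "continuous_on ({0..1} \<times> S5) (\<lambda>z. join_id (\<lambda>x. h (fst z, x)) (snd z))"
      unfolding join_id_def
      by (intro continuous_on_Pair continuous_on_snd continuous_on_id) simp
    show "equivariant_on S5 (rot3 u v w) (rot3 u v w) (\<lambda>x. join_id (\<lambda>y. h (fst (t, x), y)) (snd (t, x)))"
      if "t \<in> {0..1}" for t
      using equivariant_join_id[OF h(5)[OF that] assms(2,3), of w] by simp
  qed (use hn h(3,4) norm_join_id in simp_all)
qed

lemma equivariantly_equivalent_join:
  assumes "equivariantly_equivalent S3 (rot u v) (rot u' v')"
    and cm: "cmod u = 1" "cmod v = 1" "cmod u' = 1" "cmod v' = 1"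
  shows "equivariantly_equivalent S5 (rot3 u v w) (rot3 u' v' w)"
proof -
  obtain f g where fg: "continuous_on S3 f" "equivariant_on S3 (rot u v) (rot u' v') f"
      "continuous_on S3 g" "equivariant_on S3 (rot u' v') (rot u v) g"
      "homotopic_with_canon (equivariant_on S3 (rot u v) (rot u v)) S3 S3 (g \<circ> f) id"
      "homotopic_with_canon (equivariant_on S3 (rot u' v') (rot u' v')) S3 S3 (f \<circ> g) id"
    using assms(1) unfolding equivariantly_equivalent_def by blast
  have n: "norm (f x) = 1" "norm (g x) = 1" if "norm x = 1" for x
    using fg(2,4) that by (simp_all add: equivariant_on_def)
  have cont: "continuous_on S5 (join_id j)" if "continuous_on S3 j" "\<And>x. norm x = 1 \<Longrightarrow> norm (j x) = 1" for j
    unfolding join_id_def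
    by (intro continuous_on_Pair continuous_on_snd continuous_on_id
        continuous_on_compose2[OF continuous_cone_ext[OF that]] continuous_on_fst) auto
  have comp: "join_id g \<circ> join_id f = join_id (g \<circ> f)" "join_id f \<circ> join_id g = join_id (f \<circ> g)" "join_id id = id"
    by (simp_all add: fun_eq_iff join_id_def cone_ext_compose n)
  have "homotopic_with_canon (equivariant_on S5 (rot3 u v w) (rot3 u v w)) S5 S5 (join_id g \<circ> join_id f) id"
      "homotopic_with_canon (equivariant_on S5 (rot3 u' v' w) (rot3 u' v' w)) S5 S5 (join_id f \<circ> join_id g) id"
    using homotopic_join_id[OF fg(5) cm(1,2), of w] homotopic_join_id[OF fg(6) cm(3,4), of w]
    by (simp_all only: comp)
  then show ?thesis
    unfolding equivariantly_equivalent_def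
    using cont[OF fg(1) n(1)] cont[OF fg(3) n(2)] equivariant_join_id[OF fg(2) cm(1,2), of w]
      equivariant_join_id[OF fg(4) cm(3,4), of w] by blast
qed

text \<open>A cyclic permutation of coordinates is invertible and equivariant, so constant
  homotopies suffice.\<close>

lemma equivariantly_equivalent_cycle:
  "equivariantly_equivalent S5 (rot3 u v w) (rot3 v w u)"
proof -
  define f g :: "(complex \<times> complex) \<times> complex \<Rightarrow> (complex \<times> complex) \<times> complex"
    where "f x = ((snd (fst x), snd x), fst (fst x))" and "g x = ((snd x, fst (fst x)), snd (fst x))" for x
  have "continuous_on S5 f" "continuous_on S5 g"
    unfolding f_def g_def by (intro continuous_intros)+
  moreover have "norm (f x) = norm x" "norm (g x) = norm x" for x
    by (simp_all add: f_def g_def norm_prod_def)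
  then have "equivariant_on S5 (rot3 u v w) (rot3 v w u) f" "equivariant_on S5 (rot3 v w u) (rot3 u v w) g"
      "g \<circ> f = id" "f \<circ> g = id"
    by (simp_all add: equivariant_on_def rot3_def rot_def f_def g_def fun_eq_iff)
  ultimately show ?thesis
    unfolding equivariantly_equivalent_def by (intro exI[of _ f] exI[of _ g]) (simp add: equivariant_on_def)
qed

section \<open>Passage to the quotient\<close>

text \<open>The interval is locally compact Hausdorff, so its product with a quotient map is again a
  quotient map and the homotopy descends.\<close>

lemma homotopic_with_quotient:
  assumes p: "quotient_map (top_of_set S) Q p" and p': "quotient_map (top_of_set S) Q' p'"
    and hom: "homotopic_with_canon P S S f g"
    and resp: "\<And>j x y. P j \<Longrightarrow> x \<in> S \<Longrightarrow> y \<in> S \<Longrightarrow> p x = p y \<Longrightarrow> p' (j x) = p' (j y)"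
    and F: "\<And>x. x \<in> S \<Longrightarrow> F (p x) = p' (f x)" and G: "\<And>x. x \<in> S \<Longrightarrow> G (p x) = p' (g x)"
  shows "homotopic_with (\<lambda>_. True) Q Q' F G"
proof -
  let ?I = "top_of_set {0..1::real}"
  obtain h where h: "continuous_map (prod_topology ?I (top_of_set S)) (top_of_set S) h"
    "\<And>x. h (0, x) = f x" "\<And>x. h (1, x) = g x" "\<And>t. t \<in> {0..1} \<Longrightarrow> P (\<lambda>x. h (t, x))"
    using hom unfolding homotopic_with_def by blast
  have "locally_compact_space ?I"
    by (simp add: compact_imp_locally_compact_space compact_space_subtopology)
  moreover have "Hausdorff_space ?I"
    by (simp add: Hausdorff_space_subtopology)
  ultimately have quot: "quotient_map (prod_topology ?I (top_of_set S)) (prod_topology ?I Q) (\<lambda>(t, x). (t, p x))"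
    using p by (intro quotient_map_prod_right) auto
  have "continuous_map (prod_topology ?I (top_of_set S)) Q' (p' \<circ> h)"
    by (rule continuous_map_compose[OF h(1) quotient_imp_continuous_map[OF p']])
  moreover have "(p' \<circ> h) z = (p' \<circ> h) z'"
    if "z \<in> topspace (prod_topology ?I (top_of_set S))" "z' \<in> topspace (prod_topology ?I (top_of_set S))"
      "(\<lambda>(t, x). (t, p x)) z = (\<lambda>(t, x). (t, p x)) z'" for z z'
  proof -
    obtain t x t' x' where z: "z = (t, x)" "z' = (t', x')"
      by (cases z, cases z')
    then have "t \<in> {0..1}" "x \<in> S" "x' \<in> S" "t' = t" "p x = p x'"
      using that by auto
    then show ?thesis
      using resp[OF h(4), of t x x'] z by simp
  qed
  ultimately obtain k where k: "continuous_map (prod_topology ?I Q) Q' k"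
    "\<And>z. z \<in> topspace (prod_topology ?I (top_of_set S)) \<Longrightarrow> k ((\<lambda>(t, x). (t, p x)) z) = (p' \<circ> h) z"
    using quotient_map_lift_exists[OF quot, of Q' "p' \<circ> h"] by metis
  have kp: "k (t, p x) = p' (h (t, x))" if "t \<in> {0..1}" "x \<in> S" for t x
    using k(2)[of "(t, x)"] that by simp
  have Q: "topspace Q = p ` S"
    using quotient_imp_surjective_map[OF p] by simp
  have "(\<forall>x\<in>topspace Q. k (0, x) = F x) \<and> (\<forall>x\<in>topspace Q. k (1, x) = G x)"
    unfolding Q using kp F G h(2,3) by auto
  then show ?thesis
    using k(1) by (subst homotopic_with) auto
qed

text \<open>Forward powers describe full orbits for the rotations used here, which have finite
  order.\<close>

definition orbit_map :: "'a set \<Rightarrow> ('a \<Rightarrow> 'a) \<Rightarrow> ('a \<Rightarrow> 'b) \<Rightarrow> bool" where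
  "orbit_map S a p \<longleftrightarrow> (\<forall>x\<in>S. a x \<in> S \<and> p (a x) = p x) \<and>
     (\<forall>x\<in>S. \<forall>y\<in>S. p x = p y \<longrightarrow> (\<exists>i. y = (a ^^ i) x))"

lemma orbit_map_funpow:
  assumes "orbit_map S a p" "x \<in> S"
  shows "(a ^^ i) x \<in> S \<and> p ((a ^^ i) x) = p x"
  using assms by (induction i) (auto simp: orbit_map_def)

lemma equivariant_on_orbit_map:
  assumes a: "orbit_map S a p" and b: "orbit_map S b p'" and f: "equivariant_on S a b f"
    and xy: "x \<in> S" "y \<in> S" "p x = p y"
  shows "p' (f x) = p' (f y)"
proof -
  obtain i where i: "y = (a ^^ i) x"
    using a xy unfolding orbit_map_def by blast
  have "f ((a ^^ i) x) = (b ^^ i) (f x)" for i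
    using f orbit_map_funpow[OF a xy(1)] by (induction i) (auto simp: equivariant_on_def)
  moreover have "f x \<in> S"
    using f xy by (simp add: equivariant_on_def)
  ultimately show ?thesis
    using orbit_map_funpow[OF b] i by simp
qed

lemma homotopy_equivalent_quotients:
  assumes p: "quotient_map (top_of_set S) Q p" and p': "quotient_map (top_of_set S) Q' p'"
    and a: "orbit_map S a p" and b: "orbit_map S b p'" and eq: "equivariantly_equivalent S a b"
  shows "Q homotopy_equivalent_space Q'"
proof -
  obtain f g where fg: "continuous_on S f" "equivariant_on S a b f" "continuous_on S g" "equivariant_on S b a g"
      "homotopic_with_canon (equivariant_on S a a) S S (g \<circ> f) id"
      "homotopic_with_canon (equivariant_on S b b) S S (f \<circ> g) id"
    using eq unfolding equivariantly_equivalent_def by blast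
  have S: "f \<in> S \<rightarrow> S" "g \<in> S \<rightarrow> S"
    using fg by (auto simp: equivariant_on_def)
  have "continuous_map (top_of_set S) Q' (p' \<circ> f)"
    by (rule continuous_map_compose[OF _ quotient_imp_continuous_map[OF p']]) (use fg S in simp)
  then obtain F where F: "continuous_map Q Q' F" "\<And>x. x \<in> S \<Longrightarrow> F (p x) = p' (f x)"
    using quotient_map_lift_exists[OF p, of Q' "p' \<circ> f"] equivariant_on_orbit_map[OF a b fg(2)]
    by (metis comp_apply topspace_euclidean_subtopology)
  have "continuous_map (top_of_set S) Q (p \<circ> g)"
    by (rule continuous_map_compose[OF _ quotient_imp_continuous_map[OF p]]) (use fg S in simp)
  then obtain G where G: "continuous_map Q' Q G" "\<And>x. x \<in> S \<Longrightarrow> G (p' x) = p (g x)"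
    using quotient_map_lift_exists[OF p', of Q "p \<circ> g"] equivariant_on_orbit_map[OF b a fg(4)]
    by (metis comp_apply topspace_euclidean_subtopology)
  have "homotopic_with (\<lambda>_. True) Q Q (G \<circ> F) id"
  proof (rule homotopic_with_quotient[OF p p fg(5)])
    show "p (j x) = p (j y)" if "equivariant_on S a a j" "x \<in> S" "y \<in> S" "p x = p y" for j x y
      using equivariant_on_orbit_map[OF a a] that by blast
    show "(G \<circ> F) (p x) = p ((g \<circ> f) x)" if "x \<in> S" for x
      using F(2)[OF that] G(2)[of "f x"] that S by auto
  qed simp
  moreover have "homotopic_with (\<lambda>_. True) Q' Q' (F \<circ> G) id"
  proof (rule homotopic_with_quotient[OF p' p' fg(6)])
    show "p' (j x) = p' (j y)" if "equivariant_on S b b j" "x \<in> S" "y \<in> S" "p' x = p' y" for j x y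
      using equivariant_on_orbit_map[OF b b] that by blast
    show "(F \<circ> G) (p' x) = p' ((f \<circ> g) x)" if "x \<in> S" for x
      using G(2)[OF that] F(2)[of "g x"] that S by auto
  qed simp
  ultimately show ?thesis
    unfolding homotopy_equivalent_space_def using F(1) G(1) by blast
qed

section \<open>Lens spaces\<close>

definition to_complex3 :: "real^6 \<Rightarrow> (complex \<times> complex) \<times> complex" where
  "to_complex3 v = ((Complex (v$1) (v$2), Complex (v$3) (v$4)), Complex (v$5) (v$6))"

definition of_complex3 :: "(complex \<times> complex) \<times> complex \<Rightarrow> real^6" where
  "of_complex3 z = vector [Re (fst (fst z)), Im (fst (fst z)), Re (snd (fst z)), Im (snd (fst z)),
     Re (snd z), Im (snd z)]"

lemma to_of_complex3 [simp]: "to_complex3 (of_complex3 z) = z"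
  by (simp add: to_complex3_def of_complex3_def)

lemma of_to_complex3 [simp]: "of_complex3 (to_complex3 v) = v"
  by (simp add: to_complex3_def of_complex3_def vec_eq_iff forall_6)

lemma norm_to_complex3 [simp]: "norm (to_complex3 v) = norm v"
  by (simp add: to_complex3_def norm_Pair cmod_def norm_eq_sqrt_inner[of v] inner_vec_def sum_6
      power2_eq_square[symmetric] add.assoc)

lemma norm_of_complex3 [simp]: "norm (of_complex3 z) = norm z"
  using norm_to_complex3[of "of_complex3 z"] by simp

lemma continuous_to_complex3: "continuous_on S to_complex3"
  unfolding to_complex3_def Complex_eq by (intro continuous_intros)

lemma continuous_of_complex3: "continuous_on S of_complex3"
proof -
  have "continuous_on S (\<lambda>z. of_complex3 z $ i)" for i
    using exhaust_6[of i] unfolding of_complex3_def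
    by (elim disjE; simp only: vector_6; intro continuous_intros)
  then show ?thesis
    using continuous_on_vec_lambda[of S "\<lambda>i z. of_complex3 z $ i"] by (simp add: vec_nth_inverse)
qed

lemma quotient_map_of_complex3:
  "quotient_map (top_of_set S5) (top_of_set (sphere 0 1)) of_complex3"
proof -
  have "homeomorphic_maps (top_of_set S5) (top_of_set (sphere 0 1)) of_complex3 to_complex3"
    by (auto simp: homeomorphic_maps_def continuous_to_complex3 continuous_of_complex3)
  then show ?thesis
    using homeomorphic_maps_imp_map homeomorphic_map_def by blast
qed

lemma to_complex3_block_rotation:
  "to_complex3 (block_rotation a b c *v v) = rot3 (cis a) (cis b) (cis c) (to_complex3 v)"
  by (simp add: to_complex3_def block_rotation_def rot3_def rot_def matrix_vector_mult_def sum_6 complex_eq_iff)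

lemma funpow_rot3: "(rot3 u v w ^^ i) x = rot3 (u ^ i) (v ^ i) (w ^ i) x"
  by (induction i arbitrary: x) (simp_all add: rot3_def rot_def)

abbreviation zrot :: "nat \<Rightarrow> int \<Rightarrow> int \<Rightarrow> int \<Rightarrow> (complex \<times> complex) \<times> complex \<Rightarrow> (complex \<times> complex) \<times> complex" where
  "zrot q s\<^sub>1 s\<^sub>2 s\<^sub>3 \<equiv> rot3 (zeta q s\<^sub>1) (zeta q s\<^sub>2) (zeta q s\<^sub>3)"

lemma zrot_funpow: "zrot q s\<^sub>1 s\<^sub>2 s\<^sub>3 ^^ i = zrot q (int i * s\<^sub>1) (int i * s\<^sub>2) (int i * s\<^sub>3)"
  by (simp add: fun_eq_iff funpow_rot3 zeta_power)

lemma zrot_cong: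
  assumes "q > 0" "[s\<^sub>1 = a\<^sub>1] (mod int q)" "[s\<^sub>2 = a\<^sub>2] (mod int q)" "[s\<^sub>3 = a\<^sub>3] (mod int q)"
  shows "zrot q s\<^sub>1 s\<^sub>2 s\<^sub>3 = zrot q a\<^sub>1 a\<^sub>2 a\<^sub>3"
  using zeta_cong[OF assms(1)] assms(2-4) by metis

lemma norm_zrot [simp]: "norm (zrot q s\<^sub>1 s\<^sub>2 s\<^sub>3 x) = norm x"
proof -
  have "norm (zrot q s\<^sub>1 s\<^sub>2 s\<^sub>3 x) = norm (fst x, snd x)"
    by (simp only: rot3_def norm_Pair norm_rot cmod_zeta norm_mult mult_1)
  then show ?thesis by simp
qed

lemma zrot_period:
  assumes "q > 0"
  shows "zrot q s\<^sub>1 s\<^sub>2 s\<^sub>3 ^^ q = id"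
proof -
  have "zeta q (int q * s) = 1" for s
    using assms by (simp add: zeta_eq_1_iff)
  then show ?thesis
    by (simp add: zrot_funpow fun_eq_iff rot3_def rot_def)
qed

text \<open>The generator has finite order, so the generated group acts through nonnegative powers
  only.\<close>

lemma orbit_lens_group:
  assumes q: "q > 0"
  shows "orbit (lens_group q s\<^sub>1 s\<^sub>2 s\<^sub>3) (*v) (of_complex3 z) = range (\<lambda>i. of_complex3 ((zrot q s\<^sub>1 s\<^sub>2 s\<^sub>3 ^^ i) z))"
proof -
  let ?G = "special_orthogonal_group :: (real^6^6) monoid"
  let ?\<gamma> = "lens_generator q s\<^sub>1 s\<^sub>2 s\<^sub>3" and ?\<rho> = "zrot q s\<^sub>1 s\<^sub>2 s\<^sub>3"
  interpret group ?G by (rule group_special_orthogonal_group)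
  have gen: "to_complex3 (?\<gamma> *v v) = ?\<rho> (to_complex3 v)" for v
    by (simp add: lens_generator_def to_complex3_block_rotation zeta_def)
  have 1: "\<exists>i. \<forall>v. to_complex3 (A *v v) = (?\<rho> ^^ i) (to_complex3 v)" if "A \<in> generate ?G {?\<gamma>}" for A
    using that
  proof induction
    case one
    show ?case by (rule exI[of _ 0]) (simp add: special_orthogonal_group_def)
  next
    case (incl h)
    then show ?case by (intro exI[of _ 1]) (simp add: gen)
  next
    case (inv h)
    then have h: "h = ?\<gamma>" by simp
    have "?\<gamma> \<otimes>\<^bsub>?G\<^esub> inv\<^bsub>?G\<^esub> ?\<gamma> = \<one>\<^bsub>?G\<^esub>"
      by (rule r_inv) (rule lens_generator_in_special_orthogonal_group)
    then have m: "?\<gamma> ** inv\<^bsub>?G\<^esub> ?\<gamma> = mat 1"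
      by (simp add: special_orthogonal_group_def)
    \<comment> \<open>The inverse acts as the \<open>(q - 1)\<close>-st power.\<close>
    have "to_complex3 (inv\<^bsub>?G\<^esub> ?\<gamma> *v v) = (?\<rho> ^^ (q - 1)) (to_complex3 v)" for v
    proof -
      have "?\<rho> (to_complex3 (inv\<^bsub>?G\<^esub> ?\<gamma> *v v)) = to_complex3 v"
        by (simp add: m matrix_vector_mul_assoc flip: gen)
      then have "(?\<rho> ^^ (q - 1)) (to_complex3 v) = (?\<rho> ^^ Suc (q - 1)) (to_complex3 (inv\<^bsub>?G\<^esub> ?\<gamma> *v v))"
        by (simp only: funpow_Suc_right o_apply)
      then show ?thesis
        using q zrot_period[OF q, of s\<^sub>1 s\<^sub>2 s\<^sub>3] by simp
    qed
    then show ?case unfolding h by blast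
  next
    case (eng h1 h2)
    then obtain i j where "\<forall>v. to_complex3 (h1 *v v) = (?\<rho> ^^ i) (to_complex3 v)"
        "\<forall>v. to_complex3 (h2 *v v) = (?\<rho> ^^ j) (to_complex3 v)"
      by blast
    then have "\<forall>v. to_complex3 ((h1 ** h2) *v v) = (?\<rho> ^^ (i + j)) (to_complex3 v)"
      by (simp add: funpow_add flip: matrix_vector_mul_assoc)
    then show ?case by (auto simp: special_orthogonal_group_def)
  qed
  have 2: "\<exists>A\<in>generate ?G {?\<gamma>}. \<forall>v. to_complex3 (A *v v) = (?\<rho> ^^ i) (to_complex3 v)" for i
  proof (induction i)
    case 0
    show ?case
      by (rule bexI[OF _ generate.one]) (simp add: special_orthogonal_group_def)
  next
    case (Suc i)
    then obtain A where A: "A \<in> generate ?G {?\<gamma>}" "\<forall>v. to_complex3 (A *v v) = (?\<rho> ^^ i) (to_complex3 v)"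
      by blast
    then have "\<forall>v. to_complex3 ((?\<gamma> ** A) *v v) = (?\<rho> ^^ Suc i) (to_complex3 v)"
      by (simp add: gen flip: matrix_vector_mul_assoc)
    moreover have "?\<gamma> ** A \<in> generate ?G {?\<gamma>}"
      using generate.eng[OF generate.incl[of ?\<gamma> "{?\<gamma>}" ?G] A(1)] by (simp add: special_orthogonal_group_def)
    ultimately show ?case by blast
  qed
  have "orbit (lens_group q s\<^sub>1 s\<^sub>2 s\<^sub>3) (*v) (of_complex3 z) = {A *v of_complex3 z |A. A \<in> generate ?G {?\<gamma>}}"
    by (simp add: orbit_def lens_group_def)
  also have "\<dots> = range (\<lambda>i. of_complex3 ((?\<rho> ^^ i) z))"
  proof (intro Set.set_eqI iffI)
    fix x assume "x \<in> {A *v of_complex3 z |A. A \<in> generate ?G {?\<gamma>}}"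
    then obtain A where A: "x = A *v of_complex3 z" "A \<in> generate ?G {?\<gamma>}"
      by blast
    then obtain i where "to_complex3 x = (?\<rho> ^^ i) z"
      using 1[OF A(2)] by auto
    then have "x = of_complex3 ((?\<rho> ^^ i) z)"
      using of_to_complex3[of x] by simp
    then show "x \<in> range (\<lambda>i. of_complex3 ((?\<rho> ^^ i) z))"
      by blast
  next
    fix x assume "x \<in> range (\<lambda>i. of_complex3 ((?\<rho> ^^ i) z))"
    then obtain i where i: "x = of_complex3 ((?\<rho> ^^ i) z)" by blast
    obtain A where A: "A \<in> generate ?G {?\<gamma>}" "\<forall>v. to_complex3 (A *v v) = (?\<rho> ^^ i) (to_complex3 v)"
      using 2 by blast
    have "x = A *v of_complex3 z"
      using of_to_complex3[of "A *v of_complex3 z"] A(2) i by simp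
    then show "x \<in> {A *v of_complex3 z |A. A \<in> generate ?G {?\<gamma>}}"
      using A(1) by blast
  qed
  finally show ?thesis .
qed

text \<open>Multiplying all weights by a unit \<open>k\<close> only chooses another generator of the
  same cyclic group, so the orbits do not change.\<close>

lemma lens_space_orbit_map:
  assumes q: "q > 0" and k: "coprime k (int q)"
  obtains p where "quotient_map (top_of_set S5) (lens_space q s\<^sub>1 s\<^sub>2 s\<^sub>3) p"
    "orbit_map S5 (zrot q (k * s\<^sub>1) (k * s\<^sub>2) (k * s\<^sub>3)) p"
proof -
  let ?\<rho> = "zrot q s\<^sub>1 s\<^sub>2 s\<^sub>3" and ?a = "zrot q (k * s\<^sub>1) (k * s\<^sub>2) (k * s\<^sub>3)"
  define p where "p = orbit (lens_group q s\<^sub>1 s\<^sub>2 s\<^sub>3) (*v) \<circ> of_complex3"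
  have p: "p z = range (\<lambda>i. of_complex3 ((?\<rho> ^^ i) z))" for z
    by (simp add: p_def orbit_lens_group[OF q])
  define j where "j = nat (k mod int q)"
  have "[k = int j] (mod int q)"
    using q by (simp add: j_def cong_def)
  then have "[k * s = int j * s] (mod int q)" for s
    by (rule cong_scalar_right)
  then have a: "?a = ?\<rho> ^^ j"
    unfolding zrot_funpow by (intro zrot_cong[OF q])
  \<comment> \<open>An inverse of \<open>k\<close> recovers the original generator as a power of the
    new one.\<close>
  obtain j' where "[k * int j' = 1] (mod int q)"
    using cong_inverse[OF k q] by blast
  then have "[int j' * (k * s) = s] (mod int q)" for s
    using cong_scalar_right[of "k * int j'" 1 "int q" s] by (simp add: mult_ac)
  then have \<rho>: "?a ^^ j' = ?\<rho>"
    unfolding zrot_funpow by (intro zrot_cong[OF q])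
  have "p (?a z) = p z" for z
  proof
    have "(?\<rho> ^^ i) (?a z) = (?\<rho> ^^ (i + j)) z" for i
      by (simp add: a funpow_add)
    then show "p (?a z) \<subseteq> p z" by (auto simp: p)
    \<comment> \<open>Together with the \<open>j\<close> steps from \<open>z\<close> to
      \<open>?a z\<close>, the shift \<open>j * (q - 1)\<close> makes \<open>q * j\<close> steps,
      which is the identity.\<close>
    have "(?\<rho> ^^ i) z = (?\<rho> ^^ (i + j * (q - 1))) (?a z)" for i
    proof -
      have "(?\<rho> ^^ (i + j * (q - 1))) (?a z) = (?\<rho> ^^ (i + j * (q - 1) + j)) z"
        unfolding a funpow_add by simp
      also have "i + j * (q - 1) + j = i + q * j"
        using q by (cases q) simp_all
      also have "(?\<rho> ^^ (i + q * j)) z = (?\<rho> ^^ i) z"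
        by (simp add: funpow_add zrot_period[OF q] flip: funpow_mult)
      finally show ?thesis by simp
    qed
    then show "p z \<subseteq> p (?a z)" by (auto simp: p)
  qed
  moreover have "\<exists>i. y = (?a ^^ i) z" if "p z = p y" for y z
  proof -
    have "of_complex3 ((?\<rho> ^^ 0) y) \<in> p y"
      unfolding p by (rule rangeI)
    then have "of_complex3 y \<in> p z"
      using that by simp
    then obtain i where "of_complex3 y = of_complex3 ((?\<rho> ^^ i) z)"
      unfolding p by blast
    then have "y = (?\<rho> ^^ i) z"
      by (metis to_of_complex3)
    then have "y = (?a ^^ (j' * i)) z"
      by (simp add: \<rho> flip: funpow_mult)
    then show ?thesis by blast
  qed
  ultimately have "orbit_map S5 ?a p"
    by (simp add: orbit_map_def)
  moreover have "quotient_map (top_of_set S5) (lens_space q s\<^sub>1 s\<^sub>2 s\<^sub>3) p"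
    unfolding p_def lens_space_def
    by (rule quotient_map_compose[OF quotient_map_of_complex3 quotient_map_quotient_topology])
  ultimately show thesis using that by blast
qed

section \<open>Elementary moves between lens spaces\<close>

lemma lens_space_homotopy_equivalent:
  assumes "q > 0" "coprime k (int q)" "equivariantly_equivalent S5 (zrot q s\<^sub>1 s\<^sub>2 s\<^sub>3) (zrot q (k * a\<^sub>1) (k * a\<^sub>2) (k * a\<^sub>3))"
  shows "lens_space q s\<^sub>1 s\<^sub>2 s\<^sub>3 homotopy_equivalent_space lens_space q a\<^sub>1 a\<^sub>2 a\<^sub>3"
proof -
  obtain p where p: "quotient_map (top_of_set S5) (lens_space q s\<^sub>1 s\<^sub>2 s\<^sub>3) p" "orbit_map S5 (zrot q s\<^sub>1 s\<^sub>2 s\<^sub>3) p"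
    using lens_space_orbit_map[OF assms(1), of 1 s\<^sub>1 s\<^sub>2 s\<^sub>3] by auto
  obtain p' where p': "quotient_map (top_of_set S5) (lens_space q a\<^sub>1 a\<^sub>2 a\<^sub>3) p'"
      "orbit_map S5 (zrot q (k * a\<^sub>1) (k * a\<^sub>2) (k * a\<^sub>3)) p'"
    using lens_space_orbit_map[OF assms(1,2)] .
  show ?thesis
    by (rule homotopy_equivalent_quotients[OF p(1) p'(1) p(2) p'(2) assms(3)])
qed

text \<open>Both spaces are quotients by one and the same rotation, so the identity
  descends.\<close>

lemma lens_space_scale:
  assumes "q > 0" "coprime k (int q)"
  shows "lens_space q (k * s\<^sub>1) (k * s\<^sub>2) (k * s\<^sub>3) homotopy_equivalent_space lens_space q s\<^sub>1 s\<^sub>2 s\<^sub>3"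
proof (rule lens_space_homotopy_equivalent[OF assms])
  show "equivariantly_equivalent S5 (zrot q (k * s\<^sub>1) (k * s\<^sub>2) (k * s\<^sub>3)) (zrot q (k * s\<^sub>1) (k * s\<^sub>2) (k * s\<^sub>3))"
    unfolding equivariantly_equivalent_def
    by (intro exI[of _ id]) (simp add: equivariant_on_def)
qed

lemma lens_space_cycle:
  assumes "q > 0"
  shows "lens_space q s\<^sub>1 s\<^sub>2 s\<^sub>3 homotopy_equivalent_space lens_space q s\<^sub>2 s\<^sub>3 s\<^sub>1"
  using lens_space_homotopy_equivalent[OF assms, of 1] equivariantly_equivalent_cycle by simp

lemma lens_space_exchange:
  assumes "q > 0" "coprime s\<^sub>1 (int q)" "coprime s\<^sub>2 (int q)" "coprime a\<^sub>1 (int q)" "coprime a\<^sub>2 (int q)"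
    and "[a\<^sub>1 * a\<^sub>2 = s\<^sub>1 * s\<^sub>2] (mod int q)"
  shows "lens_space q s\<^sub>1 s\<^sub>2 s\<^sub>3 homotopy_equivalent_space lens_space q a\<^sub>1 a\<^sub>2 s\<^sub>3"
  using lens_space_homotopy_equivalent[OF assms(1), of 1]
    equivariantly_equivalent_join[OF equivariantly_equivalent_S3[OF assms]] by simp

text \<open>Scaling the target weights by \<open>k\<close> multiplies their product by
  \<open>k ^ 3\<close>, after which the products agree. One exchange then installs
  \<open>k * a\<^sub>1\<close>, and a second one the other two weights.\<close>

lemma lens_space_homotopy_equivalent_of_cube:
  assumes q: "q > 0" and k: "coprime k (int q)"
    and s: "coprime s\<^sub>1 (int q)" "coprime s\<^sub>2 (int q)" "coprime s\<^sub>3 (int q)"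
    and a: "coprime a\<^sub>1 (int q)" "coprime a\<^sub>2 (int q)" "coprime a\<^sub>3 (int q)"
    and prod: "[k ^ 3 * (a\<^sub>1 * a\<^sub>2 * a\<^sub>3) = s\<^sub>1 * s\<^sub>2 * s\<^sub>3] (mod int q)"
  shows "lens_space q s\<^sub>1 s\<^sub>2 s\<^sub>3 homotopy_equivalent_space lens_space q a\<^sub>1 a\<^sub>2 a\<^sub>3"
proof -
  note homotopy_eqv_trans[trans]
  have ka: "coprime (k * a\<^sub>1) (int q)" "coprime (k * a\<^sub>2) (int q)" "coprime (k * a\<^sub>3) (int q)"
    using k a by simp_all
  obtain t where t: "[k * a\<^sub>1 * int t = 1] (mod int q)"
    using cong_inverse[OF ka(1) q] by blast
  \<comment> \<open>The intermediate weight is forced by preserving the product of the first two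
    weights.\<close>
  define w where "w = s\<^sub>1 * s\<^sub>2 * int t"
  have w1: "[k * a\<^sub>1 * w = s\<^sub>1 * s\<^sub>2] (mod int q)"
    using cong_scalar_right[OF t, of "s\<^sub>1 * s\<^sub>2"] by (simp add: w_def mult_ac)
  have "coprime (k * a\<^sub>1 * w) (int q)"
    using w1 s cong_imp_coprime cong_sym coprime_mult_left_iff by blast
  then have w: "coprime w (int q)" by simp
  have "[k * a\<^sub>1 * (k * a\<^sub>2 * (k * a\<^sub>3)) = s\<^sub>1 * s\<^sub>2 * s\<^sub>3] (mod int q)"
    using prod by (simp add: power3_eq_cube mult_ac)
  moreover have "[k * a\<^sub>1 * (w * s\<^sub>3) = s\<^sub>1 * s\<^sub>2 * s\<^sub>3] (mod int q)"
    using cong_scalar_right[OF w1, of s\<^sub>3] by (simp add: mult.assoc)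
  ultimately have "[k * a\<^sub>1 * (k * a\<^sub>2 * (k * a\<^sub>3)) = k * a\<^sub>1 * (w * s\<^sub>3)] (mod int q)"
    using cong_trans cong_sym by blast
  then have w2: "[k * a\<^sub>2 * (k * a\<^sub>3) = w * s\<^sub>3] (mod int q)"
    by (simp only: cong_mult_lcancel[OF ka(1)])
  have "lens_space q s\<^sub>1 s\<^sub>2 s\<^sub>3 homotopy_equivalent_space lens_space q (k * a\<^sub>1) w s\<^sub>3"
    by (rule lens_space_exchange[OF q s(1,2) ka(1) w w1])
  \<comment> \<open>The shift brings the two weights still to be exchanged into the first two
    places.\<close>
  also have "\<dots> homotopy_equivalent_space lens_space q w s\<^sub>3 (k * a\<^sub>1)"
    by (rule lens_space_cycle[OF q])
  also have "\<dots> homotopy_equivalent_space lens_space q (k * a\<^sub>2) (k * a\<^sub>3) (k * a\<^sub>1)"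
    by (rule lens_space_exchange[OF q w s(3) ka(2,3) w2])
  also have "\<dots> homotopy_equivalent_space lens_space q a\<^sub>2 a\<^sub>3 a\<^sub>1"
    by (rule lens_space_scale[OF q k])
  also have "\<dots> homotopy_equivalent_space lens_space q a\<^sub>3 a\<^sub>1 a\<^sub>2"
    by (rule lens_space_cycle[OF q])
  also have "\<dots> homotopy_equivalent_space lens_space q a\<^sub>1 a\<^sub>2 a\<^sub>3"
    by (rule lens_space_cycle[OF q])
  finally show ?thesis .
qed

section \<open>The cube congruence for the two weight triples\<close>

theorem lemma7p6:
  fixes r t :: nat
  assumes "r > 0" and "t > 0" and "\<not> [r = 0] (mod 3)"
  shows "lens_space (r\<^sup>2 * t) 1 (1 + int r * int t) (1 + 3 * int r * int t)
           homotopy_equivalent_space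
         lens_space (r\<^sup>2 * t) 1 (1 - int r * int t) (1 - 3 * int r * int t)"
proof -
  have q: "r\<^sup>2 * t > 0" using assms by simp
  \<comment> \<open>A common divisor with \<open>r\<close> or with \<open>t\<close> divides
    \<open>y * r * t\<close> and hence 1; this covers \<open>k\<close> and every weight.\<close>
  have cop: "coprime (1 + y * int r * int t) (int (r\<^sup>2 * t))" for y
  proof -
    have "coprime (1 + y * int r * int t) (int r)" "coprime (1 + y * int r * int t) (int t)"
      by (rule coprimeI, metis dvd_add_left_iff dvd_mult dvd_mult2 mult.commute)+
    then show ?thesis by simp
  qed
  have "coprime 3 r"
  proof (rule coprimeI)
    fix d :: nat assume d: "d dvd 3" "d dvd r"
    then have "d \<le> 3" by (intro dvd_imp_le) simp_all
    then have "d = 0 \<or> d = 1 \<or> d = 2 \<or> d = 3" by linarith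
    then show "d dvd 1"
      using d assms(3) by (auto simp: cong_0_iff)
  qed
  then have "coprime (3::int) (int r)"
    using coprime_int_iff[of 3 r] by simp
  then obtain x where x: "[3 * x = 1] (mod int r)"
    using cong_solve_coprime_int by blast
  \<comment> \<open>Modulo \<open>m\<^sup>2\<close>, where \<open>m = r * t\<close>, the congruence
    for \<open>k = 1 + a * m\<close> compares the linear coefficients \<open>3 * a - 4\<close> and
    4. Hence \<open>3 * a \<equiv> 8\<close> modulo \<open>r\<close> is needed, and 3 is invertible
    there.\<close>
  define a where "a = 8 * x"
  have "[8 * (3 * x) = 8 * 1] (mod int r)"
    by (rule cong_scalar_left[OF x])
  then have "int r dvd 3 * a - 8"
    by (simp add: a_def cong_iff_dvd_diff)
  then obtain b where b: "3 * a = 8 + int r * b"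
    by (metis add.commute diff_add_cancel dvd_def)
  define k where "k = 1 + a * int r * int t"
  define m where "m = int r * int t"
  \<comment> \<open>The cofactor of \<open>m\<^sup>2\<close> in the expanded difference of the two
    products.\<close>
  define c where "c = 3 * a\<^sup>2 + a ^ 3 * m - 4 * (3 * a + 3 * a\<^sup>2 * m + a ^ 3 * m\<^sup>2) + 3 * k ^ 3 - 3"
  have k: "k = 1 + a * m"
    by (simp add: k_def m_def mult.assoc)
  have "k ^ 3 * (1 * (1 - m) * (1 - 3 * m)) - 1 * (1 + m) * (1 + 3 * m) = (3 * a - 8) * m + m\<^sup>2 * c"
    unfolding c_def k by algebra
  \<comment> \<open>One factor \<open>r\<close> comes from \<open>3 * a - 8\<close> and the other
    from \<open>m\<close>, so the linear term is divisible by \<open>r\<^sup>2 * t\<close>.\<close>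
  also have "(3 * a - 8) * m = int (r\<^sup>2 * t) * b"
    unfolding b m_def by (simp add: power2_eq_square)
  also have "m\<^sup>2 * c = int (r\<^sup>2 * t) * (int t * c)"
    by (simp add: power2_eq_square m_def)
  finally have "[k ^ 3 * (1 * (1 - m) * (1 - 3 * m)) = 1 * (1 + m) * (1 + 3 * m)] (mod int (r\<^sup>2 * t))"
    unfolding cong_iff_dvd_diff by (simp only: dvd_add dvd_triv_left)
  then have "[k ^ 3 * (1 * (1 - int r * int t) * (1 - 3 * int r * int t)) =
      1 * (1 + int r * int t) * (1 + 3 * int r * int t)] (mod int (r\<^sup>2 * t))"
    by (simp only: m_def mult.assoc)
  then show ?thesis
    by (rule lens_space_homotopy_equivalent_of_cube[OF q, rotated -1])
      (use cop[of a] cop[of 0] cop[of 1] cop[of 3] cop[of "-1"] cop[of "-3"] in \<open>simp_all add: k_def\<close>)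
qed

end
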